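(* Let $T>0$ and the spatial mesh size $h>0$ be fixed. Let $f:\mathbb{R}\to\mathbb{R}$ and $\beta>0$ be such that $f(\beta)\le0\le f(-\beta)$ and $f$ is twice continuously differentiable and nonconstant on $[-\beta,\beta]$. Let $\|u_0\|_{L^\infty}\le\beta$. Assume that $\boldsymbol u\in\mathcal C([0,T];\mathbb{R}^N)$, with $\|\boldsymbol u(t)\|_\infty\le\beta$ for all $t\in[0,T]$, is the exact solution of $$\frac{d\boldsymbol u}{dt}=\boldsymbol A\boldsymbol u+\boldsymbol f(\boldsymbol u),\qquad \boldsymbol u(0)=(u_0(x_1),\dots,u_0(x_N))^T,$$ and that $\{\boldsymbol U_m\}_{m=0}^M$ is the numerical solution generated by the LRI2 scheme: $\boldsymbol U_0=\boldsymbol u(0)$ and, for $m=0,\dots,M-1$, $$\boldsymbol U_{m+1}=e^{\Delta t\boldsymbol A}\boldsymbol U_m+\frac{\Delta t}{2}\Bigl[e^{\Delta t\boldsymbol A}\boldsymbol f(\boldsymbol U_m)+\boldsymbol f(e^{\Delta t\boldsymbol A}\boldsymbol U_m)\Bigr]+\frac{\Delta t^2}{2}e^{\Delta t\boldsymbol A}\frac{\partial\boldsymbol f}{\partial\boldsymbol u}(\boldsymbol U_m)\boldsymbol f(\boldsymbol U_m).$$ Then there exists a constant $C=C(\beta,\delta_0,\omega_0,F_0,F_1,\widetilde{F_1},F_2,\widetilde{F_2},F_3,\|\boldsymbol A\|_\infty)>0$, independent of $\Delta t$, such that for all $0<\Delta t\le\delta_0\omega_0$, $$\|\boldsymbol U_m-\boldsymbol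 u(t_m)\|_\infty\le C\,(e^{F_4t_m}-1)\,\Delta t^2,\qquad m=0,1,\dots,M,$$ where $F_4:=F_1+\frac12\delta_0\omega_0F_3$.
   Context: Setting (space discretization by central finite differences, homogeneous Neumann boundary conditions, of $\partial_t u=\varepsilon^2\Delta u+f(u)$ on $\Omega$ with initial datum $u_0:\overline\Omega\to\mathbb{R}$): $d\in\{1,2,3\}$, $\Omega\subset\mathbb{R}^d$ is an open bounded interval ($d=1$), rectangle ($d=2$) or rectangular parallelepiped ($d=3$), $\varepsilon>0$. A uniform grid with mesh size $h>0$ in every direction is used, with $n_k\ge2$ grid points (boundary points included) in direction $k$, $N=n_1\cdots n_d$, and grid points $x_1,\dots,x_N\in\overline\Omega$ (first coordinate varying fastest). For $n\ge 2$ let $\boldsymbol\lambda_h^{(n)}$ be $\frac1{h^2}$ times the $n\times n$ tridiagonal matrix with all diagonal entries $-2$, first row $(-2,2,0,\dots,0)$, last row $(0,\dots,0,2,-2)$, and every interior row having entries $1,-2,1$ in the sub-, main and superdiagonal positions. Set $\boldsymbol D_h=\boldsymbol\lambda_h^{(n_1)}$ if $d=1$; $\boldsymbol D_h=\boldsymbol I\otimes\boldsymbol\lambda_h^{(n_1)}+\boldsymbol\lambda_h^{(n_2)}\otimes\boldsymbol I$ if $d=2$; $\boldsymbol D_h=\boldsymbol I\otimes\boldsymbol I\otimes\boldsymbol\lambda_h^{(n_1)}+\boldsymbol I\otimes\boldsymbol\lambda_h^{(n_2)}\otimes\boldsymbol I+\boldsymbol\lambda_h^{(n_3)}\otimes\boldsymbol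 I\otimes\boldsymbol I$ if $d=3$ ($\otimes$ is the Kronecker product, $\boldsymbol I$ identity matrices of the appropriate sizes), and $\boldsymbol A=\varepsilon^2\boldsymbol D_h\in\mathbb{R}^{N\times N}$. Time grid: $M$ is a positive integer, $\Delta t=T/M$, $t_m=m\Delta t$. Constants: $\omega_0=-1/\min_{|x|\le\beta}f'(x)>0$ (the minimum is negative); $\omega_1=-\min_{|x|\le\beta}[f''(x)f(x)]$; $\delta_0=\min\{1,\delta\}$ with $\delta=\frac{-1+\sqrt{1+7\omega_0^2\omega_1}}{2\omega_0^2\omega_1}$ if $\omega_1>0$, and $\delta_0=1$ if $\omega_1\le0$; $F_0=\max_{|x|\le\beta}|f(x)|$, $F_1=\max_{|x|\le\beta}|f'(x)|$, $F_2=\max_{|x|\le\beta}|f''(x)|$, $F_3=\max_{|x|\le\beta}|(f'f)'(x)|$, $\widetilde{F_1}=\max_{|x|\le\beta+\delta_0\omega_0F_0}|f'(x)|$, $\widetilde{F_2}=\max_{|x|\le\beta+\delta_0\omega_0F_0}|f''(x)|$. Notation: $\boldsymbol f(\boldsymbol v)=(f(v_1),\dots,f(v_N))^T$ and $\frac{\partial\boldsymbol f}{\partial\boldsymbol u}(\boldsymbol v)=\mathrm{diag}(f'(v_1),\dots,f'(v_N))$ for $\boldsymbol v\in\mathbb{R}^N$; $\|\cdot\|_\infty$ is the maximum norm on $\mathbb{R}^N$ and the induced matrix norm; $\|u_0\|_{L^\infty}=\max_{x\in\overline\Omega}|u_0(x)|$. *)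

theory Defs
  imports
    "HOL-Analysis.Analysis"
    "HOL-Library.Extended_Real"
    "Jordan_Normal_Form.Matrix"
begin

unbundle no vec_syntax
unbundle no inner_syntax

text \<open>Vectors and matrices carry their dimension as a value (\<^theory>\<open>Jordan_Normal_Form.Matrix\<close>),
  so that one constant can be asserted to work uniformly in the number of grid points.\<close>

subsection \<open>Maximum norms and the matrix exponential\<close>

definition vec_maxnorm :: "real Matrix.vec \<Rightarrow> real" where
  "vec_maxnorm v = Max ((\<lambda>i. \<bar>v $ i\<bar>) ` {..<dim_vec v})"

definition mat_maxnorm :: "real mat \<Rightarrow> real" where
  "mat_maxnorm A =
     (SUP v \<in> {v. dim_vec v = dim_col A \<and> v \<noteq> 0\<^sub>v (dim_col A)}. vec_maxnorm (A *\<^sub>v v) / vec_maxnorm v)"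

definition mat_exp :: "real mat \<Rightarrow> real mat" where
  "mat_exp A = Matrix.mat (dim_row A) (dim_row A) (\<lambda>(i, j). \<Sum>k. (A ^\<^sub>m k) $$ (i, j) / fact k)"

text \<open>The supremum is taken in the extended reals, so that a bound on it entails boundedness.\<close>

definition sup_norm_on :: "'a set \<Rightarrow> ('a \<Rightarrow> real) \<Rightarrow> ereal" where
  "sup_norm_on X g = (SUP x \<in> X. ereal \<bar>g x\<bar>)"

subsection \<open>The finite difference discretization\<close>

text \<open>The list \<open>ns\<close> holds the numbers of grid points in the coordinate directions; its length is the
  spatial dimension. The closure of the open box \<open>\<Omega>\<close> with opposite corners \<open>a\<close> and \<open>b\<close> is
  \<open>{a..b}\<close>, since the order on vectors is componentwise.\<close>

definition uniform_grid :: "real Matrix.vec \<Rightarrow> real Matrix.vec \<Rightarrow> nat list \<Rightarrow> real \<Rightarrow> bool" where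
  "uniform_grid a b ns h \<longleftrightarrow>
     length ns \<in> {1, 2, 3} \<and> dim_vec a = length ns \<and> dim_vec b = length ns \<and>
     (\<forall>k < length ns. 2 \<le> ns ! k \<and> a $ k < b $ k \<and> b $ k - a $ k = real (ns ! k - 1) * h)"

text \<open>Points and matrix entries are numbered from 0; in the mixed-radix numbering of the grid points
  the first coordinate varies fastest.\<close>

definition grid_point :: "real Matrix.vec \<Rightarrow> real \<Rightarrow> nat list \<Rightarrow> nat \<Rightarrow> real Matrix.vec" where
  "grid_point a h ns i =
     Matrix.vec (length ns) (\<lambda>k. a $ k + real (i div prod_list (take k ns) mod (ns ! k)) * h)"

definition grid_values ::
  "real Matrix.vec \<Rightarrow> real \<Rightarrow> nat list \<Rightarrow> (real Matrix.vec \<Rightarrow> real) \<Rightarrow> real Matrix.vec" where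
  "grid_values a h ns u0 = Matrix.vec (prod_list ns) (\<lambda>i. u0 (grid_point a h ns i))"

definition neumann_laplacian :: "real \<Rightarrow> nat \<Rightarrow> real mat" where
  "neumann_laplacian h n = (1 / h\<^sup>2) \<cdot>\<^sub>m Matrix.mat n n (\<lambda>(i, j).
     if i = j then - 2
     else if (i = 0 \<and> j = 1) \<or> (i = n - 1 \<and> j = n - 2) then 2
     else if j = i + 1 \<or> i = j + 1 then 1
     else 0)"

definition kronecker :: "real mat \<Rightarrow> real mat \<Rightarrow> real mat" (infixl "\<otimes>\<^sub>k" 72) where
  "A \<otimes>\<^sub>k B = Matrix.mat (dim_row A * dim_row B) (dim_col A * dim_col B)
     (\<lambda>(i, j). A $$ (i div dim_row B, j div dim_col B) * B $$ (i mod dim_row B, j mod dim_col B))"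

definition discrete_laplacian :: "real \<Rightarrow> nat list \<Rightarrow> real mat" where
  "discrete_laplacian h ns = (case ns of
       [n1] \<Rightarrow> neumann_laplacian h n1
     | [n1, n2] \<Rightarrow> 1\<^sub>m n2 \<otimes>\<^sub>k neumann_laplacian h n1 + neumann_laplacian h n2 \<otimes>\<^sub>k 1\<^sub>m n1
     | [n1, n2, n3] \<Rightarrow>
         1\<^sub>m n3 \<otimes>\<^sub>k 1\<^sub>m n2 \<otimes>\<^sub>k neumann_laplacian h n1
       + 1\<^sub>m n3 \<otimes>\<^sub>k neumann_laplacian h n2 \<otimes>\<^sub>k 1\<^sub>m n1
       + neumann_laplacian h n3 \<otimes>\<^sub>k 1\<^sub>m n2 \<otimes>\<^sub>k 1\<^sub>m n1
     | _ \<Rightarrow> undefined)"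

subsection \<open>The nonlinearity and its constants\<close>

text \<open>Derivatives are taken relative to \<open>[-r, r]\<close>, i.e. one-sided at the end points. If \<open>g\<close> is
  differentiable on a neighbourhood of a point of \<open>[-r, r]\<close>, this is the ordinary derivative there.\<close>

definition deriv_on :: "real \<Rightarrow> (real \<Rightarrow> real) \<Rightarrow> real \<Rightarrow> real" where
  "deriv_on r g x = vector_derivative g (at x within {-r..r})"

definition C2_on :: "real \<Rightarrow> (real \<Rightarrow> real) \<Rightarrow> bool" where
  "C2_on r g \<longleftrightarrow> g differentiable_on {-r..r} \<and> deriv_on r g differentiable_on {-r..r} \<and>
     continuous_on {-r..r} (deriv_on r (deriv_on r g))"

text \<open>For continuous \<open>g\<close>, suprema and infima over the compact interval \<open>[-r, r]\<close> are maxima and minima.\<close>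

definition max_abs :: "real \<Rightarrow> (real \<Rightarrow> real) \<Rightarrow> real" where
  "max_abs r g = (SUP x \<in> {-r..r}. \<bar>g x\<bar>)"

definition omega0 :: "real \<Rightarrow> (real \<Rightarrow> real) \<Rightarrow> real" where
  "omega0 \<beta> f = - 1 / (INF x \<in> {-\<beta>..\<beta>}. deriv_on \<beta> f x)"

definition omega1 :: "real \<Rightarrow> (real \<Rightarrow> real) \<Rightarrow> real" where
  "omega1 \<beta> f = - (INF x \<in> {-\<beta>..\<beta>}. deriv_on \<beta> (deriv_on \<beta> f) x * f x)"

definition delta0 :: "real \<Rightarrow> (real \<Rightarrow> real) \<Rightarrow> real" where
  "delta0 \<beta> f =
     (if omega1 \<beta> f > 0
      then min 1 ((- 1 + sqrt (1 + 7 * (omega0 \<beta> f)\<^sup>2 * omega1 \<beta> f)) / (2 * (omega0 \<beta> f)\<^sup>2 * omega1 \<beta> f))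
      else 1)"

definition F0 :: "real \<Rightarrow> (real \<Rightarrow> real) \<Rightarrow> real" where
  "F0 \<beta> f = max_abs \<beta> f"

definition F1 :: "real \<Rightarrow> (real \<Rightarrow> real) \<Rightarrow> real" where
  "F1 \<beta> f = max_abs \<beta> (deriv_on \<beta> f)"

definition F2 :: "real \<Rightarrow> (real \<Rightarrow> real) \<Rightarrow> real" where
  "F2 \<beta> f = max_abs \<beta> (deriv_on \<beta> (deriv_on \<beta> f))"

definition F3 :: "real \<Rightarrow> (real \<Rightarrow> real) \<Rightarrow> real" where
  "F3 \<beta> f = max_abs \<beta> (deriv_on \<beta> (\<lambda>x. deriv_on \<beta> f x * f x))"

definition F4 :: "real \<Rightarrow> (real \<Rightarrow> real) \<Rightarrow> real" where
  "F4 \<beta> f = F1 \<beta> f + 1 / 2 * delta0 \<beta> f * omega0 \<beta> f * F3 \<beta> f"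

definition wide_radius :: "real \<Rightarrow> (real \<Rightarrow> real) \<Rightarrow> real" where
  "wide_radius \<beta> f = \<beta> + delta0 \<beta> f * omega0 \<beta> f * F0 \<beta> f"

text \<open>These two are maxima when \<open>f\<close> is twice continuously differentiable on the wider interval as
  well; otherwise their values are unspecified.\<close>

definition F1_wide :: "real \<Rightarrow> (real \<Rightarrow> real) \<Rightarrow> real" where
  "F1_wide \<beta> f = max_abs (wide_radius \<beta> f) (deriv_on (wide_radius \<beta> f) f)"

definition F2_wide :: "real \<Rightarrow> (real \<Rightarrow> real) \<Rightarrow> real" where
  "F2_wide \<beta> f = max_abs (wide_radius \<beta> f) (deriv_on (wide_radius \<beta> f) (deriv_on (wide_radius \<beta> f) f))"

subsection \<open>Exact solution and numerical scheme\<close>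

definition ode_solution ::
  "real \<Rightarrow> real mat \<Rightarrow> (real \<Rightarrow> real) \<Rightarrow> real Matrix.vec \<Rightarrow> (real \<Rightarrow> real Matrix.vec) \<Rightarrow> bool" where
  "ode_solution T A f v0 u \<longleftrightarrow>
     u 0 = v0 \<and>
     (\<forall>t \<in> {0..T}. dim_vec (u t) = dim_row A) \<and>
     (\<forall>i < dim_row A. continuous_on {0..T} (\<lambda>t. u t $ i)) \<and>
     (\<forall>i < dim_row A. \<forall>t \<in> {0..T}.
        ((\<lambda>s. u s $ i) has_real_derivative (A *\<^sub>v u t + map_vec f (u t)) $ i) (at t within {0..T}))"

text \<open>The diagonal matrix of the values \<open>f'(v\<^sub>i)\<close>, for \<open>v\<close> with entries in \<open>[-\<beta>, \<beta>]\<close>; the scheme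
  keeps its iterates there under the step size restriction it is used with.\<close>

definition jacobian :: "real \<Rightarrow> (real \<Rightarrow> real) \<Rightarrow> real Matrix.vec \<Rightarrow> real mat" where
  "jacobian \<beta> f v =
     Matrix.mat (dim_vec v) (dim_vec v) (\<lambda>(i, j). if i = j then deriv_on \<beta> f (v $ i) else 0)"

definition lri2_step ::
  "real \<Rightarrow> (real \<Rightarrow> real) \<Rightarrow> real mat \<Rightarrow> real \<Rightarrow> real Matrix.vec \<Rightarrow> real Matrix.vec" where
  "lri2_step \<beta> f A \<tau> v =
     (let E = mat_exp (\<tau> \<cdot>\<^sub>m A) in
      E *\<^sub>v v
      + (\<tau> / 2) \<cdot>\<^sub>v (E *\<^sub>v map_vec f v + map_vec f (E *\<^sub>v v))
      + (\<tau>\<^sup>2 / 2) \<cdot>\<^sub>v (E *\<^sub>v (jacobian \<beta> f v *\<^sub>v map_vec f v)))"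

definition lri2_solution ::
  "real \<Rightarrow> (real \<Rightarrow> real) \<Rightarrow> real mat \<Rightarrow> real \<Rightarrow> nat \<Rightarrow> real Matrix.vec \<Rightarrow> (nat \<Rightarrow> real Matrix.vec) \<Rightarrow> bool" where
  "lri2_solution \<beta> f A \<tau> M v0 U \<longleftrightarrow>
     U 0 = v0 \<and> (\<forall>m < M. U (Suc m) = lri2_step \<beta> f A \<tau> (U m))"

end

theory Submission
  imports Defs
begin

text \<open>The semigroup \<open>e\<^bsup>\<tau>A\<^esup>\<close> averages: \<open>A + c I\<close> has nonnegative entries for large \<open>c\<close>, and the rows of \<open>A\<close>
  sum to zero. Hence the semigroup contracts the maximum norm, and the step size restriction turns the
  scheme into a sum of averages of monotone functions, which keeps its iterates in \<open>[-\<beta>, \<beta>]\<close>. There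
  one step is Lipschitz with constant \<open>1 + \<tau> F\<^sub>4\<close>, and its expansion agrees with the Taylor expansion
  of the exact solution up to terms of order \<open>\<tau>\<^sup>3\<close>. All derivatives of the solution and the remainders
  of the exponential are bounded in terms of \<open>\<parallel>A\<parallel>\<close>, so the local errors add up to the claim.\<close>

subsection \<open>The semigroup generated by a rate matrix\<close>

text \<open>The hypotheses control \<open>f\<close> on \<open>[-\<beta>, \<beta>]\<close> only, so
  every point at which \<open>f\<close> or a derivative of it is evaluated has to lie there: the
  iterates, their averages and the exact solution. This is why invariance of the interval and the
  error estimate share one induction, and why derivatives at the end points are one-sided. The error
  constant may not depend on the number of grid points. Estimates therefore see the matrix only
  through its sign pattern, its row sums and the operator bound \<alpha>. Third order accuracy of
  one step is reached with two derivatives of \<open>f\<close>: the second time derivative of the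
  solution contains only the first derivative of \<open>f\<close>, and the scheme needs
  \<open>f\<close> expanded just to first order with a quadratic remainder. The factor
  \<open>exp (F4 t) - 1\<close> is a supersolution of the error recursion
  \<open>e' = (1 + \<tau> F4) e + c \<tau>^3\<close>. Making it dominate the local errors means
  dividing by \<open>F4\<close>, which is positive because \<open>f\<close> is not constant.\<close>

locale rate_matrix =
  fixes N :: nat and a :: "nat \<Rightarrow> nat \<Rightarrow> real" and \<alpha> :: real
  assumes offdiag_nonneg: "\<lbrakk>i < N; j < N; i \<noteq> j\<rbrakk> \<Longrightarrow> 0 \<le> a i j"
    and row_sum: "i < N \<Longrightarrow> (\<Sum>j<N. a i j) = 0"
    and norm_nonneg: "0 \<le> \<alpha>"
    and op_bound: "\<lbrakk>\<And>j. j < N \<Longrightarrow> \<bar>x j\<bar> \<le> B; i < N\<rbrakk> \<Longrightarrow> \<bar>\<Sum>j<N. a i j * x j\<bar> \<le> \<alpha> * B"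
begin

definition L :: "(nat \<Rightarrow> real) \<Rightarrow> nat \<Rightarrow> real" where
  "L x i = (\<Sum>j<N. a i j * x j)"

definition heat :: "real \<Rightarrow> (nat \<Rightarrow> real) \<Rightarrow> nat \<Rightarrow> real" where
  "heat \<tau> x i = (\<Sum>k. \<tau> ^ k / fact k * (L ^^ k) x i)"

lemma L_bound: "\<lbrakk>\<And>j. j < N \<Longrightarrow> \<bar>x j\<bar> \<le> B; i < N\<rbrakk> \<Longrightarrow> \<bar>L x i\<bar> \<le> \<alpha> * B"
  unfolding L_def by (rule op_bound)

lemma L_linear: "L (\<lambda>j. p * x j + q * y j) i = p * L x i + q * L y i"
  by (simp add: L_def sum_distrib_left sum.distrib algebra_simps)

lemma L_sum: "L (\<lambda>j. \<Sum>l\<in>S. x l j) i = (\<Sum>l\<in>S. L (x l) i)"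
  unfolding L_def sum_distrib_left by (rule sum.swap)

lemma L_cmult: "L (\<lambda>j. p * x j) i = p * L x i"
  by (simp add: L_def sum_distrib_left algebra_simps)

text \<open>Vectors are functions on all of \<open>nat\<close> whose values from \<open>N\<close> on
  are arbitrary. Agreement below \<open>N\<close> therefore takes the place of equality.\<close>

lemma L_cong: "(\<And>j. j < N \<Longrightarrow> x j = y j) \<Longrightarrow> L x i = L y i"
  by (simp add: L_def)

lemma L_iter_cong: "(\<And>j. j < N \<Longrightarrow> x j = y j) \<Longrightarrow> i < N \<Longrightarrow> (L ^^ k) x i = (L ^^ k) y i"
proof (induction k arbitrary: i)
  case (Suc k)
  then show ?case by (auto intro: L_cong)
qed simp

lemma L_iter_linear: "(L ^^ k) (\<lambda>j. p * x j + q * y j) = (\<lambda>j. p * (L ^^ k) x j + q * (L ^^ k) y j)"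
  by (induction k) (auto simp: L_linear)

lemma L_iter_bound:
  assumes "\<And>j. j < N \<Longrightarrow> \<bar>x j\<bar> \<le> B" and "i < N"
  shows "\<bar>(L ^^ k) x i\<bar> \<le> \<alpha> ^ k * B"
  using assms(2)
proof (induction k arbitrary: i)
  case 0
  then show ?case using assms by simp
next
  case (Suc k)
  then have "\<bar>L ((L ^^ k) x) i\<bar> \<le> \<alpha> * (\<alpha> ^ k * B)" by (intro L_bound) auto
  then show ?case by (simp add: mult.assoc)
qed

section \<open>Convergence, linearity and remainders of the exponential series\<close>

lemma heat_cong: "(\<And>j. j < N \<Longrightarrow> x j = y j) \<Longrightarrow> i < N \<Longrightarrow> heat \<tau> x i = heat \<tau> y i"
  using L_iter_cong unfolding heat_def by metis

lemma heat_term_bound: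
  assumes "0 \<le> \<tau>" and "\<And>j. j < N \<Longrightarrow> \<bar>x j\<bar> \<le> B" and "i < N"
  shows "\<bar>\<tau> ^ k / fact k * (L ^^ k) x i\<bar> \<le> B * ((\<alpha> * \<tau>) ^ k / fact k)"
proof -
  have "\<bar>\<tau> ^ k / fact k * (L ^^ k) x i\<bar> = \<tau> ^ k / fact k * \<bar>(L ^^ k) x i\<bar>"
    using assms(1) by (simp add: abs_mult)
  also have "\<dots> \<le> \<tau> ^ k / fact k * (\<alpha> ^ k * B)"
    using L_iter_bound[of x B i k] assms by (intro mult_left_mono) auto
  finally show ?thesis by (simp add: power_mult_distrib algebra_simps)
qed

lemma exp_terms_summable: "summable (\<lambda>k. (t::real) ^ k / fact k)"
  using summable_exp_generic[of t] by (simp add: divide_inverse mult.commute)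

text \<open>Absolute convergence is what the Cauchy product in \<open>heat_shifted\<close> calls
  for.\<close>

lemma heat_abs_summable:
  assumes "0 \<le> \<tau>" and "i < N"
  shows "summable (\<lambda>k. \<bar>\<tau> ^ k / fact k * (L ^^ k) x i\<bar>)"
proof (rule summable_comparison_test')
  show "summable (\<lambda>k. (\<Sum>j<N. \<bar>x j\<bar>) * ((\<alpha> * \<tau>) ^ k / fact k))"
    by (intro summable_mult exp_terms_summable)
next
  fix k :: nat assume "k \<ge> 0"
  have "\<bar>x j\<bar> \<le> (\<Sum>j<N. \<bar>x j\<bar>)" if "j < N" for j
    using that by (intro member_le_sum) auto
  then show "norm \<bar>\<tau> ^ k / fact k * (L ^^ k) x i\<bar> \<le> (\<Sum>j<N. \<bar>x j\<bar>) * ((\<alpha> * \<tau>) ^ k / fact k)"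
    using heat_term_bound assms by simp
qed

lemma heat_summable: "\<lbrakk>0 \<le> \<tau>; i < N\<rbrakk> \<Longrightarrow> summable (\<lambda>k. \<tau> ^ k / fact k * (L ^^ k) x i)"
  by (rule summable_rabs_cancel) (rule heat_abs_summable)

lemma heat_linear:
  assumes "0 \<le> \<tau>" and "i < N"
  shows "heat \<tau> (\<lambda>j. p * x j + q * y j) i = p * heat \<tau> x i + q * heat \<tau> y i"
proof -
  have "(\<lambda>k. p * (\<tau> ^ k / fact k * (L ^^ k) x i) + q * (\<tau> ^ k / fact k * (L ^^ k) y i))
      sums (p * heat \<tau> x i + q * heat \<tau> y i)"
    unfolding heat_def using assms by (intro sums_add sums_mult summable_sums heat_summable)
  then have "(\<lambda>k. \<tau> ^ k / fact k * (L ^^ k) (\<lambda>j. p * x j + q * y j) i)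
      sums (p * heat \<tau> x i + q * heat \<tau> y i)"
    by (simp add: L_iter_linear algebra_simps)
  then show ?thesis
    unfolding heat_def by (simp add: sums_iff)
qed

lemma heat_tail:
  assumes "0 \<le> \<tau>" and "\<And>j. j < N \<Longrightarrow> \<bar>x j\<bar> \<le> B" and "i < N"
  shows "\<bar>heat \<tau> x i - (\<Sum>k<n. \<tau> ^ k / fact k * (L ^^ k) x i)\<bar> \<le> (\<alpha> * \<tau>) ^ n * exp (\<alpha> * \<tau>) * B"
proof -
  define c where "c k = \<tau> ^ k / fact k * (L ^^ k) x i" for k
  have B: "0 \<le> B" using assms(2)[OF assms(3)] by linarith
  have t: "0 \<le> \<alpha> * \<tau>" using norm_nonneg assms(1) by simp
  have "heat \<tau> x i - sum c {..<n} = (\<Sum>k. c (k + n))"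
    using suminf_minus_initial_segment[OF heat_summable[OF assms(1,3), of x], of n]
    by (simp add: heat_def c_def)
  moreover have "\<bar>\<Sum>k. c (k + n)\<bar> \<le> (\<Sum>k. B * (\<alpha> * \<tau>) ^ n * ((\<alpha> * \<tau>) ^ k / fact k))"
  proof (rule norm_suminf_le[where 'a = real, unfolded real_norm_def])
    fix k
    have "\<bar>c (k + n)\<bar> \<le> B * ((\<alpha> * \<tau>) ^ (k + n) / fact (k + n))"
      unfolding c_def by (rule heat_term_bound[OF assms])
    \<comment> \<open>Since \<open>fact (k + n)\<close> is at least \<open>fact k\<close>, the tail
      is dominated by \<open>(\<alpha> * \<tau>) ^ n\<close> times a full exponential series. The
      gain \<open>1 / fact n\<close> is given away.\<close>
    also have "\<dots> \<le> B * ((\<alpha> * \<tau>) ^ (k + n) / fact k)"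
      using B t by (intro mult_left_mono divide_left_mono fact_mono) auto
    finally show "\<bar>c (k + n)\<bar> \<le> B * (\<alpha> * \<tau>) ^ n * ((\<alpha> * \<tau>) ^ k / fact k)"
      by (simp add: power_add algebra_simps)
  next
    show "summable (\<lambda>k. B * (\<alpha> * \<tau>) ^ n * ((\<alpha> * \<tau>) ^ k / fact k))"
      by (intro summable_mult exp_terms_summable)
  qed
  moreover have "(\<Sum>k. B * (\<alpha> * \<tau>) ^ n * ((\<alpha> * \<tau>) ^ k / fact k)) = B * (\<alpha> * \<tau>) ^ n * exp (\<alpha> * \<tau>)"
    by (subst suminf_mult[OF exp_terms_summable])
       (simp add: exp_def divide_inverse mult.commute)
  ultimately show ?thesis by (simp add: c_def algebra_simps)
qed

section \<open>Positivity and contraction of the semigroup\<close>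

definition shifted :: "real \<Rightarrow> (nat \<Rightarrow> real) \<Rightarrow> nat \<Rightarrow> real" where
  "shifted c x i = L x i + c * x i"

text \<open>The binomial theorem for the commuting operators \<open>L\<close> and multiplication by
  \<open>c\<close>.\<close>

lemma shifted_iter:
  "(shifted c ^^ k) x i = (\<Sum>j\<le>k. real (k choose j) * c ^ (k - j) * (L ^^ j) x i)"
proof (induction k arbitrary: i)
  case 0
  then show ?case by simp
next
  case (Suc k)
  let ?y = "\<lambda>j. (L ^^ j) x i"
  have IH: "(shifted c ^^ k) x = (\<lambda>i. \<Sum>j\<le>k. real (k choose j) * c ^ (k - j) * (L ^^ j) x i)"
    using Suc by blast
  have "(shifted c ^^ Suc k) x i
      = (\<Sum>j\<le>k. real (k choose j) * c ^ (k - j) * ?y (Suc j))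
        + c * (\<Sum>j\<le>k. real (k choose j) * c ^ (k - j) * ?y j)"
    by (simp add: shifted_def IH L_sum L_cmult)
  also have "c * (\<Sum>j\<le>k. real (k choose j) * c ^ (k - j) * ?y j)
      = (\<Sum>j\<le>k. real (k choose j) * c ^ (Suc k - j) * ?y j)"
    unfolding sum_distrib_left by (intro sum.cong) (auto simp: Suc_diff_le)
  \<comment> \<open>The added term vanishes because \<open>k choose Suc k = 0\<close>. With it, the
    term of index 0 can be split off, and Pascal's rule combines the two shifted sums.\<close>
  also have "\<dots> = (\<Sum>j\<le>Suc k. real (k choose j) * c ^ (Suc k - j) * ?y j)"
    by simp
  also have "\<dots> = c ^ Suc k * ?y 0 + (\<Sum>j\<le>k. real (k choose Suc j) * c ^ (k - j) * ?y (Suc j))"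
    by (subst sum.atMost_Suc_shift) simp
  also have "(\<Sum>j\<le>k. real (k choose j) * c ^ (k - j) * ?y (Suc j)) + \<dots>
      = c ^ Suc k * ?y 0 + (\<Sum>j\<le>k. real (Suc k choose Suc j) * c ^ (k - j) * ?y (Suc j))"
    by (simp add: sum.distrib[symmetric] algebra_simps)
  also have "\<dots> = (\<Sum>j\<le>Suc k. real (Suc k choose j) * c ^ (Suc k - j) * ?y j)"
    by (subst sum.atMost_Suc_shift) simp
  finally show ?case .
qed

text \<open>As \<open>L\<close> commutes with \<open>c I\<close>, the exponential of
  \<open>\<tau> (L + c I)\<close> factors. The Cauchy product of the two series has the binomial
  expansion of \<open>shifted c ^^ k\<close> as its term of index \<open>k\<close>.\<close>

lemma heat_shifted:
  assumes "0 \<le> \<tau>" and "i < N"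
  shows "(\<lambda>k. \<tau> ^ k / fact k * (shifted c ^^ k) x i) sums (heat \<tau> x i * exp (\<tau> * c))"
proof -
  have e: "(\<Sum>k. (\<tau> * c) ^ k / fact k) = exp (\<tau> * c)"
    by (simp add: exp_def divide_inverse mult.commute)
  have "summable (\<lambda>k. norm ((\<tau> * c) ^ k / fact k))"
    using exp_terms_summable[of "\<bar>\<tau> * c\<bar>"] by (simp add: power_abs)
  from Cauchy_product_sums[OF _ this, of "\<lambda>k. \<tau> ^ k / fact k * (L ^^ k) x i"]
  have "(\<lambda>k. \<Sum>j\<le>k. \<tau> ^ j / fact j * (L ^^ j) x i * ((\<tau> * c) ^ (k - j) / fact (k - j)))
      sums (heat \<tau> x i * exp (\<tau> * c))"
    using heat_abs_summable[OF assms, of x] by (simp add: heat_def e)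
  moreover have "(\<Sum>j\<le>k. \<tau> ^ j / fact j * (L ^^ j) x i * ((\<tau> * c) ^ (k - j) / fact (k - j)))
      = \<tau> ^ k / fact k * (shifted c ^^ k) x i" for k
    unfolding shifted_iter sum_distrib_left
    by (intro sum.cong)
       (auto simp: binomial_fact power_mult_distrib field_simps simp flip: power_add)
  ultimately show ?thesis by simp
qed

lemma heat_nonneg:
  assumes "0 \<le> \<tau>" and "\<And>j. j < N \<Longrightarrow> 0 \<le> x j" and "i < N"
  shows "0 \<le> heat \<tau> x i"
proof -
  \<comment> \<open>Any bound on the diagonal entries works; the sum of their absolute values serves
    all rows at once.\<close>
  define c where "c = (\<Sum>i<N. \<bar>a i i\<bar>)"
  have c: "\<bar>a i i\<bar> \<le> c" if "i < N" for i
    unfolding c_def using that by (intro member_le_sum) auto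
  have pos: "0 \<le> shifted c y i" if y: "\<And>j. j < N \<Longrightarrow> 0 \<le> y j" and i: "i < N" for y i
  proof -
    have "shifted c y i = (\<Sum>j<N. (a i j + (if j = i then c else 0)) * y j)"
      using i by (simp add: shifted_def L_def distrib_right sum.distrib if_distrib[of "\<lambda>t. t * _"]
          cong: if_cong)
    also have "\<dots> \<ge> 0"
      using y i offdiag_nonneg[of i] c[of i] by (intro sum_nonneg mult_nonneg_nonneg) auto
    finally show ?thesis .
  qed
  have iter: "0 \<le> (shifted c ^^ k) x i" if "i < N" for k i
    using that by (induction k arbitrary: i) (auto intro: assms pos)
  have "0 \<le> heat \<tau> x i * exp (\<tau> * c)"
  proof (rule sums_le[OF _ sums_zero heat_shifted[OF assms(1,3)]])
    show "0 \<le> \<tau> ^ k / fact k * (shifted c ^^ k) x i" for k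
      using iter[OF assms(3)] assms(1) by simp
  qed
  then show ?thesis by (simp add: zero_le_mult_iff)
qed

text \<open>Vanishing row sums mean that \<open>L\<close> annihilates constants, so only the term of
  index 0 of the series remains.\<close>

lemma heat_const: "i < N \<Longrightarrow> heat \<tau> (\<lambda>_. c) i = c"
proof -
  assume i: "i < N"
  have z: "(L ^^ Suc k) (\<lambda>_. c) i = 0" if "i < N" for k i
    using that
  proof (induction k arbitrary: i)
    case 0
    then show ?case by (simp add: L_def row_sum flip: sum_distrib_right)
  next
    case (Suc k)
    then have "L ((L ^^ Suc k) (\<lambda>_. c)) i = 0"
      unfolding L_def[of "(L ^^ Suc k) (\<lambda>_. c)"] by (intro sum.neutral) auto
    then show ?case by simp
  qed
  have "heat \<tau> (\<lambda>_. c) i = (\<Sum>k\<in>{0}. \<tau> ^ k / fact k * (L ^^ k) (\<lambda>_. c) i)"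
    unfolding heat_def
  proof (rule suminf_finite)
    fix k :: nat assume "k \<notin> {0}"
    then obtain l where "k = Suc l" by (cases k) auto
    then show "\<tau> ^ k / fact k * (L ^^ k) (\<lambda>_. c) i = 0" using z[OF i, of l] by simp
  qed simp
  then show ?thesis by simp
qed

text \<open>Positivity is applied to \<open>B + x\<close> and \<open>B - x\<close>, and the constant
  \<open>B\<close> is left unchanged by the semigroup.\<close>

lemma heat_contraction:
  assumes "0 \<le> \<tau>" and "\<And>j. j < N \<Longrightarrow> \<bar>x j\<bar> \<le> B" and "i < N"
  shows "\<bar>heat \<tau> x i\<bar> \<le> B"
proof -
  have "0 \<le> heat \<tau> (\<lambda>j. 1 * B + s * x j) i" if "s = 1 \<or> s = -1" for s
    using that assms by (intro heat_nonneg) (fastforce simp: abs_le_iff)+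
  then have "0 \<le> B + s * heat \<tau> x i" if "s = 1 \<or> s = -1" for s
    using that heat_linear[OF assms(1,3), of 1 "\<lambda>_. B" s x] heat_const[OF assms(3), of \<tau> B]
    by fastforce
  from this[of 1] this[of "-1"] show ?thesis by simp
qed

end

subsection \<open>The nonlinearity and the maximum principle\<close>

text \<open>The derivative is one-sided at the end points, so its sign is used in the open interval
  and continuity covers the ends.\<close>

lemma nondecreasing_on_Icc:
  fixes g :: "real \<Rightarrow> real"
  assumes d: "\<And>x. x \<in> {l..r} \<Longrightarrow> (g has_real_derivative g' x) (at x within {l..r})"
    and nonneg: "\<And>x. x \<in> {l..r} \<Longrightarrow> 0 \<le> g' x"
    and "l \<le> x" "x \<le> y" "y \<le> r"
  shows "g x \<le> g y"
proof (rule DERIV_nonneg_imp_increasing_open[OF \<open>x \<le> y\<close>])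
  fix z assume "x < z" "z < y"
  then have "z \<in> {l<..<r}" "z \<in> {l..r}" using assms(3,5) by auto
  then have "(g has_real_derivative g' z) (at z)"
    using d[of z] at_within_Icc_at[of l z r] by auto
  then show "\<exists>c. (g has_real_derivative c) (at z) \<and> 0 \<le> c"
    using nonneg \<open>z \<in> {l..r}\<close> by blast
next
  have "continuous_on {l..r} g" using d by (rule DERIV_continuous_on)
  then show "continuous_on {x..y} g" by (rule continuous_on_subset) (use assms in auto)
qed

text \<open>\<open>F0\<close> to \<open>F3\<close> are fixed here as arbitrary upper bounds, hiding
  the constants of the same names; \<open>bistable\<close> instantiates them with those
  constants.\<close>

locale nonlinearity =
  fixes \<beta> :: real and f f1 f2 :: "real \<Rightarrow> real" and F0 F1 F2 F3 :: real
  assumes beta_pos: "0 < \<beta>"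
    and f_right: "f \<beta> \<le> 0" and f_left: "0 \<le> f (-\<beta>)"
    and f_deriv: "x \<in> {-\<beta>..\<beta>} \<Longrightarrow> (f has_real_derivative f1 x) (at x within {-\<beta>..\<beta>})"
    and f1_deriv: "x \<in> {-\<beta>..\<beta>} \<Longrightarrow> (f1 has_real_derivative f2 x) (at x within {-\<beta>..\<beta>})"
    and f_bound: "x \<in> {-\<beta>..\<beta>} \<Longrightarrow> \<bar>f x\<bar> \<le> F0"
    and f1_bound: "x \<in> {-\<beta>..\<beta>} \<Longrightarrow> \<bar>f1 x\<bar> \<le> F1"
    and f2_bound: "x \<in> {-\<beta>..\<beta>} \<Longrightarrow> \<bar>f2 x\<bar> \<le> F2"
    and f1f_deriv_bound: "x \<in> {-\<beta>..\<beta>} \<Longrightarrow> \<bar>f2 x * f x + f1 x * f1 x\<bar> \<le> F3"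
begin

lemma F_nonneg: "0 \<le> F0" "0 \<le> F1" "0 \<le> F2" "0 \<le> F3"
proof -
  have "(0::real) \<in> {-\<beta>..\<beta>}" using beta_pos by simp
  from f_bound[OF this] f1_bound[OF this] f2_bound[OF this] f1f_deriv_bound[OF this]
  show "0 \<le> F0" "0 \<le> F1" "0 \<le> F2" "0 \<le> F3" by linarith+
qed

lemma f1f_deriv:
  "x \<in> {-\<beta>..\<beta>} \<Longrightarrow>
    ((\<lambda>x. f1 x * f x) has_real_derivative f2 x * f x + f1 x * f1 x) (at x within {-\<beta>..\<beta>})"
  by (auto intro!: derivative_eq_intros f_deriv f1_deriv)

lemma f_lipschitz: "\<lbrakk>x \<in> {-\<beta>..\<beta>}; y \<in> {-\<beta>..\<beta>}\<rbrakk> \<Longrightarrow> \<bar>f x - f y\<bar> \<le> F1 * \<bar>x - y\<bar>"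
  using field_differentiable_bound[of "{-\<beta>..\<beta>}" f f1 F1 x y] f_deriv f1_bound by simp

lemma f1f_lipschitz:
  "\<lbrakk>x \<in> {-\<beta>..\<beta>}; y \<in> {-\<beta>..\<beta>}\<rbrakk> \<Longrightarrow> \<bar>f1 x * f x - f1 y * f y\<bar> \<le> F3 * \<bar>x - y\<bar>"
  using field_differentiable_bound[of "{-\<beta>..\<beta>}" "\<lambda>x. f1 x * f x" "\<lambda>x. f2 x * f x + f1 x * f1 x" F3 x y]
    f1f_deriv f1f_deriv_bound by simp

lemma f_taylor:
  assumes "x \<in> {-\<beta>..\<beta>}" "y \<in> {-\<beta>..\<beta>}"
  shows "\<bar>f y - f x - f1 x * (y - x)\<bar> \<le> F2 * (y - x)\<^sup>2"
proof -
  \<comment> \<open>Taylor's theorem takes an indexed family of derivatives, supplied by list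
    lookup. Its remainder is divided by \<open>fact 1\<close>, hence no factor 1 / 2 in the
    bound.\<close>
  have "norm (([f, f1, f2] ! 0) y - (\<Sum>i\<le>1. ([f, f1, f2] ! i) x * (y - x) ^ i / fact i))
      \<le> F2 * norm (y - x) ^ Suc 1 / fact 1"
  proof (rule field_Taylor[of "{-\<beta>..\<beta>}" 1 "\<lambda>i. [f, f1, f2] ! i"])
    fix i :: nat and z assume "z \<in> {-\<beta>..\<beta>}" "i \<le> 1"
    then show "([f, f1, f2] ! i has_real_derivative ([f, f1, f2] ! Suc i) z) (at z within {-\<beta>..\<beta>})"
      using f_deriv f1_deriv by (cases i) auto
  qed (use assms f2_bound in auto)
  then show ?thesis by (simp add: algebra_simps power2_eq_square)
qed

end

section \<open>One step of the scheme: invariant interval and stability\<close>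

locale lri2 = rate_matrix N a \<alpha> + nonlinearity \<beta> f f1 f2 F0 F1 F2 F3
  for N a \<alpha> \<beta> f f1 f2 F0 F1 F2 F3
begin

definition step :: "real \<Rightarrow> (nat \<Rightarrow> real) \<Rightarrow> nat \<Rightarrow> real" where
  "step \<tau> x i = heat \<tau> x i + \<tau> / 2 * (heat \<tau> (\<lambda>j. f (x j)) i + f (heat \<tau> x i))
     + \<tau>\<^sup>2 / 2 * heat \<tau> (\<lambda>j. f1 (x j) * f (x j)) i"

lemma heat_in_range:
  "\<lbrakk>0 \<le> \<tau>; \<And>j. j < N \<Longrightarrow> x j \<in> {-\<beta>..\<beta>}; i < N\<rbrakk> \<Longrightarrow> heat \<tau> x i \<in> {-\<beta>..\<beta>}"
  using heat_contraction[of \<tau> x \<beta> i] by (auto simp: abs_le_iff minus_le_iff)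

text \<open>Twice the step is \<open>E (Q \<circ> x) + P \<circ> E x\<close> with \<open>E\<close> the averaging operator \<open>heat \<tau>\<close>; moving
  \<open>(1 - d) x\<close> between the two halves makes both \<open>P\<close> and \<open>Q\<close> monotone on \<open>[-\<beta>, \<beta>]\<close>.\<close>

lemma step_max_principle:
  assumes \<tau>: "0 \<le> \<tau>"
    and f1_lower: "\<And>x. x \<in> {-\<beta>..\<beta>} \<Longrightarrow> - \<kappa> \<le> f1 x"
    and f2f_lower: "\<And>x. x \<in> {-\<beta>..\<beta>} \<Longrightarrow> - w \<le> f2 x * f x"
    and small: "\<tau> * \<kappa> \<le> 1" "\<tau> * \<kappa> + \<tau>\<^sup>2 * w \<le> 7 / 4"
    and x: "\<And>j. j < N \<Longrightarrow> x j \<in> {-\<beta>..\<beta>}" and i: "i < N"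
  shows "step \<tau> x i \<in> {-\<beta>..\<beta>}"
proof -
  define d where "d = \<tau> * \<kappa>"
  define P where "P y = \<tau> * f y + d * y" for y
  define Q where "Q y = (2 - d) * y + \<tau> * f y + \<tau>\<^sup>2 * (f1 y * f y)" for y
  have ends: "-\<beta> \<in> {-\<beta>..\<beta>}" "\<beta> \<in> {-\<beta>..\<beta>}" using beta_pos by auto
  have f1: "- d \<le> \<tau> * f1 y" if "y \<in> {-\<beta>..\<beta>}" for y
    using mult_left_mono[OF f1_lower[OF that] \<tau>] by (simp add: d_def)
  have P': "(P has_real_derivative \<tau> * f1 y + d) (at y within {-\<beta>..\<beta>})" if "y \<in> {-\<beta>..\<beta>}" for y
    unfolding P_def using that by (auto intro!: derivative_eq_intros f_deriv)
  have Pmono: "P y \<le> P z" if "y \<in> {-\<beta>..\<beta>}" "z \<in> {-\<beta>..\<beta>}" "y \<le> z" for y z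
    by (rule nondecreasing_on_Icc[OF P']) (use that f1 in \<open>force+\<close>)
  have Q': "(Q has_real_derivative (2 - d) + \<tau> * f1 y + \<tau>\<^sup>2 * (f2 y * f y + f1 y * f1 y))
      (at y within {-\<beta>..\<beta>})" if "y \<in> {-\<beta>..\<beta>}" for y
    unfolding Q_def using that by (auto intro!: derivative_eq_intros f_deriv f1_deriv)
  have Q'_nonneg: "0 \<le> (2 - d) + \<tau> * f1 y + \<tau>\<^sup>2 * (f2 y * f y + f1 y * f1 y)"
    if "y \<in> {-\<beta>..\<beta>}" for y
  proof -
    have "\<tau>\<^sup>2 * - w \<le> \<tau>\<^sup>2 * (f2 y * f y)"
      using f2f_lower[OF that] by (intro mult_left_mono) auto
    \<comment> \<open>The origin of 7 / 4: with \<open>s = \<tau> * f1 y\<close>, completing the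
      square gives \<open>s + s^2 \<ge> -1/4\<close>, so the derivative of \<open>Q\<close> is at
      least \<open>7/4 - d - \<tau>^2 w\<close>.\<close>
    moreover have "0 \<le> (\<tau> * f1 y + 1 / 2)\<^sup>2" by simp
    ultimately show ?thesis
      using small(2) unfolding d_def by (simp add: power2_eq_square algebra_simps)
  qed
  have Qmono: "Q y \<le> Q z" if "y \<in> {-\<beta>..\<beta>}" "z \<in> {-\<beta>..\<beta>}" "y \<le> z" for y z
    by (rule nondecreasing_on_Icc[OF Q' Q'_nonneg]) (use that in auto)
  have Pb: "\<bar>P y\<bar> \<le> d * \<beta>" if y: "y \<in> {-\<beta>..\<beta>}" for y
  proof -
    have "P y \<le> P \<beta>" "P (-\<beta>) \<le> P y" using Pmono y ends by auto
    moreover have "\<tau> * f \<beta> \<le> 0" "0 \<le> \<tau> * f (-\<beta>)"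
      using \<tau> f_left f_right by (auto simp: mult_le_0_iff)
    ultimately show ?thesis by (simp add: P_def abs_le_iff)
  qed
  have Qb: "\<bar>Q y\<bar> \<le> (2 - d) * \<beta>" if y: "y \<in> {-\<beta>..\<beta>}" for y
  proof -
    have "Q y \<le> Q \<beta>" "Q (-\<beta>) \<le> Q y" using Qmono y ends by auto
    \<comment> \<open>The factor \<open>1 + \<tau> * f1\<close> is at least \<open>1 - d\<close>,
      which is nonnegative by the first smallness condition. At the end points the correction to
      \<open>(2 - d) * y\<close> therefore has the sign of \<open>f\<close>.\<close>
    moreover have "\<tau> * f \<beta> * (1 + \<tau> * f1 \<beta>) \<le> 0" "0 \<le> \<tau> * f (-\<beta>) * (1 + \<tau> * f1 (-\<beta>))"
      using \<tau> f_left f_right f1[OF ends(1)] f1[OF ends(2)] small(1)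
      by (auto simp: d_def mult_le_0_iff zero_le_mult_iff)
    ultimately show ?thesis by (simp add: Q_def abs_le_iff algebra_simps power2_eq_square)
  qed
  let ?E = "heat \<tau>"
  have "?E (\<lambda>j. Q (x j)) i
      = (2 - d) * ?E x i + (\<tau> * ?E (\<lambda>j. f (x j)) i + \<tau>\<^sup>2 * ?E (\<lambda>j. f1 (x j) * f (x j)) i)"
    using heat_linear[OF \<tau> i, of "2 - d" x 1 "\<lambda>j. \<tau> * f (x j) + \<tau>\<^sup>2 * (f1 (x j) * f (x j))"]
      heat_linear[OF \<tau> i, of \<tau> "\<lambda>j. f (x j)" "\<tau>\<^sup>2" "\<lambda>j. f1 (x j) * f (x j)"]
    by (simp add: Q_def add.assoc)
  then have "2 * step \<tau> x i = ?E (\<lambda>j. Q (x j)) i + P (?E x i)"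
    by (simp add: step_def P_def algebra_simps)
  moreover have "\<bar>?E (\<lambda>j. Q (x j)) i\<bar> \<le> (2 - d) * \<beta>"
    using Qb x by (intro heat_contraction[OF \<tau> _ i]) auto
  moreover have "\<bar>P (?E x i)\<bar> \<le> d * \<beta>"
    using heat_in_range[OF \<tau> x i] by (rule Pb)
  ultimately have "\<bar>2 * step \<tau> x i\<bar> \<le> 2 * \<beta>" by (simp add: algebra_simps)
  then show ?thesis by (simp add: abs_le_iff)
qed

text \<open>Averages contract, so they do not enlarge Lipschitz constants, and they keep the
  argument of the outer \<open>f\<close> in the interval. Treating \<open>f1 x * f x\<close> as one
  function with constant \<open>F3\<close> gives the quadratic coefficient that \<open>F4\<close>
  prescribes.\<close>

lemma step_stable:
  assumes \<tau>: "0 \<le> \<tau>"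
    and x: "\<And>j. j < N \<Longrightarrow> x j \<in> {-\<beta>..\<beta>}" and y: "\<And>j. j < N \<Longrightarrow> y j \<in> {-\<beta>..\<beta>}"
    and e: "\<And>j. j < N \<Longrightarrow> \<bar>x j - y j\<bar> \<le> e" and i: "i < N"
  shows "\<bar>step \<tau> x i - step \<tau> y i\<bar> \<le> (1 + \<tau> * F1 + \<tau>\<^sup>2 / 2 * F3) * e"
proof -
  let ?E = "heat \<tau>"
  have diff: "\<bar>?E p i - ?E q i\<bar> \<le> B" if "\<And>j. j < N \<Longrightarrow> \<bar>p j - q j\<bar> \<le> B" for p q B
    using heat_linear[OF \<tau> i, of 1 p "-1" q] heat_contraction[OF \<tau> that i, of "\<lambda>j. j"] by simp
  have Ex: "\<bar>?E x i - ?E y i\<bar> \<le> e" by (rule diff) (rule e)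
  have Ef: "\<bar>?E (\<lambda>j. f (x j)) i - ?E (\<lambda>j. f (y j)) i\<bar> \<le> F1 * e"
    using f_lipschitz x y e F_nonneg by (intro diff order.trans[OF f_lipschitz] mult_left_mono) auto
  have Eff: "\<bar>?E (\<lambda>j. f1 (x j) * f (x j)) i - ?E (\<lambda>j. f1 (y j) * f (y j)) i\<bar> \<le> F3 * e"
    using x y e F_nonneg by (intro diff order.trans[OF f1f_lipschitz] mult_left_mono) auto
  have fE: "\<bar>f (?E x i) - f (?E y i)\<bar> \<le> F1 * e"
    using heat_in_range[OF \<tau> x i] heat_in_range[OF \<tau> y i] Ex F_nonneg
    by (intro order.trans[OF f_lipschitz] mult_left_mono) auto
  have "step \<tau> x i - step \<tau> y i = (?E x i - ?E y i)
      + (\<tau> / 2 * (?E (\<lambda>j. f (x j)) i - ?E (\<lambda>j. f (y j)) i) + \<tau> / 2 * (f (?E x i) - f (?E y i))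
      + \<tau>\<^sup>2 / 2 * (?E (\<lambda>j. f1 (x j) * f (x j)) i - ?E (\<lambda>j. f1 (y j) * f (y j)) i))"
    by (simp add: step_def algebra_simps diff_divide_distrib add_divide_distrib)
  moreover have "\<bar>\<tau> / 2 * p\<bar> \<le> \<tau> / 2 * B" "\<bar>\<tau>\<^sup>2 / 2 * p\<bar> \<le> \<tau>\<^sup>2 / 2 * B" if "\<bar>p\<bar> \<le> B" for p B
    using \<tau> that by (auto simp: abs_mult intro!: mult_left_mono)
  note this(1)[OF Ef] this(1)[OF fE] this(2)[OF Eff]
  ultimately have "\<bar>step \<tau> x i - step \<tau> y i\<bar>
      \<le> e + (\<tau> / 2 * (F1 * e) + \<tau> / 2 * (F1 * e) + \<tau>\<^sup>2 / 2 * (F3 * e))"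
    using Ex by linarith
  then show ?thesis by (simp add: algebra_simps)
qed

end

subsection \<open>Local and global error\<close>

text \<open>With \<open>D = \<alpha> \<beta> + F\<^sub>0\<close> bounding the first and \<open>(\<alpha> + F\<^sub>1) D\<close> bounding the second time derivative of
  the solution, the first constant bounds the third one. In the second constant, \<open>G\<close> bounds the factor
  \<open>e\<^bsup>\<alpha>\<tau>\<^esup>\<close> in the remainders of the exponential series.\<close>

definition taylor_const :: "real \<Rightarrow> real \<Rightarrow> real \<Rightarrow> real \<Rightarrow> real \<Rightarrow> real" where
  "taylor_const \<alpha> \<beta> B0 B1 B2 =
     (\<alpha> + B1) * ((\<alpha> + B1) * (\<alpha> * \<beta> + B0)) + B2 * (\<alpha> * \<beta> + B0)\<^sup>2"

definition expansion_const :: "real \<Rightarrow> real \<Rightarrow> real \<Rightarrow> real \<Rightarrow> real \<Rightarrow> real \<Rightarrow> real" where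
  "expansion_const G \<alpha> \<beta> B0 B1 B2 =
     \<alpha> ^ 3 * G * \<beta> + (\<alpha>\<^sup>2 * G * B0 + B1 * (\<alpha>\<^sup>2 * G * \<beta>) + B2 * (\<alpha> * G * \<beta>)\<^sup>2) / 2 + \<alpha> * G * (B1 * B0) / 2"

context lri2
begin

section \<open>Local error of one step\<close>

lemma heat_tail_le:
  assumes "0 \<le> \<tau>" "\<tau> \<le> \<sigma>" and "\<And>j. j < N \<Longrightarrow> \<bar>x j\<bar> \<le> B" and "i < N"
  shows "\<bar>heat \<tau> x i - (\<Sum>k<n. \<tau> ^ k / fact k * (L ^^ k) x i)\<bar>
      \<le> (\<alpha> * \<tau>) ^ n * exp (\<alpha> * \<sigma>) * B"
proof -
  have "0 \<le> B" using assms(3)[OF assms(4)] by linarith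
  then have "(\<alpha> * \<tau>) ^ n * exp (\<alpha> * \<tau>) * B \<le> (\<alpha> * \<tau>) ^ n * exp (\<alpha> * \<sigma>) * B"
    using assms(1,2) norm_nonneg by (intro mult_right_mono mult_left_mono) (auto intro: mult_left_mono)
  moreover have "\<bar>heat \<tau> x i - (\<Sum>k<n. \<tau> ^ k / fact k * (L ^^ k) x i)\<bar>
      \<le> (\<alpha> * \<tau>) ^ n * exp (\<alpha> * \<tau>) * B"
    by (rule heat_tail[OF assms(1,3,4)])
  ultimately show ?thesis by linarith
qed

text \<open>The mixed second order terms come from different places: \<open>L\<close> applied to
  \<open>f (x j)\<close> from the average of \<open>f\<close>, \<open>f1\<close> times
  \<open>L x\<close> from \<open>f\<close> at the average, and \<open>f1\<close> times
  \<open>f\<close> from the last term of the scheme. Together with \<open>L (L x)\<close> they form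
  the second time derivative of the flow.\<close>

lemma step_expansion:
  assumes \<tau>: "0 \<le> \<tau>" "\<tau> \<le> \<sigma>"
    and x: "\<And>j. j < N \<Longrightarrow> x j \<in> {-\<beta>..\<beta>}" and i: "i < N"
  shows "\<bar>step \<tau> x i - (x i + \<tau> * (L x i + f (x i))
      + \<tau>\<^sup>2 / 2 * (L (\<lambda>j. L x j + f (x j)) i + f1 (x i) * (L x i + f (x i))))\<bar>
    \<le> \<tau> ^ 3 * expansion_const (exp (\<alpha> * \<sigma>)) \<alpha> \<beta> F0 F1 F2"
proof -
  let ?E = "heat \<tau>"
  define G where "G = exp (\<alpha> * \<sigma>)"
  have xb: "\<bar>x j\<bar> \<le> \<beta>" if "j < N" for j using x[OF that] by (auto simp: abs_le_iff)
  have fb: "\<bar>f (x j)\<bar> \<le> F0" if "j < N" for j using x[OF that] by (rule f_bound)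
  have ffb: "\<bar>f1 (x j) * f (x j)\<bar> \<le> F1 * F0" if "j < N" for j
    using f_bound[OF x[OF that]] f1_bound[OF x[OF that]] F_nonneg
    unfolding abs_mult by (intro mult_mono) auto
  define r3 where "r3 = ?E x i - (x i + \<tau> * L x i + \<tau>\<^sup>2 / 2 * L (L x) i)"
  define p2 where "p2 = ?E x i - (x i + \<tau> * L x i)"
  define p1 where "p1 = ?E x i - x i"
  define r2 where "r2 = ?E (\<lambda>j. f (x j)) i - (f (x i) + \<tau> * L (\<lambda>j. f (x j)) i)"
  define r1 where "r1 = ?E (\<lambda>j. f1 (x j) * f (x j)) i - f1 (x i) * f (x i)"
  define q where "q = f (?E x i) - f (x i) - f1 (x i) * (?E x i - x i)"
  note tail = heat_tail_le[OF \<tau> _ i, folded G_def]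
  have r3: "\<bar>r3\<bar> \<le> (\<alpha> * \<tau>) ^ 3 * G * \<beta>"
    using tail[of x \<beta> 3, OF xb] by (simp add: r3_def eval_nat_numeral)
  have p2: "\<bar>p2\<bar> \<le> (\<alpha> * \<tau>) ^ 2 * G * \<beta>"
    using tail[of x \<beta> 2, OF xb] by (simp add: p2_def eval_nat_numeral)
  have p1: "\<bar>p1\<bar> \<le> (\<alpha> * \<tau>) * G * \<beta>"
    using tail[of x \<beta> 1, OF xb] by (simp add: p1_def)
  have r2: "\<bar>r2\<bar> \<le> (\<alpha> * \<tau>) ^ 2 * G * F0"
    using tail[of "\<lambda>j. f (x j)" F0 2, OF fb] by (simp add: r2_def eval_nat_numeral)
  have r1: "\<bar>r1\<bar> \<le> (\<alpha> * \<tau>) * G * (F1 * F0)"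
    using tail[of "\<lambda>j. f1 (x j) * f (x j)" "F1 * F0" 1, OF ffb] by (simp add: r1_def)
  have "\<bar>q\<bar> \<le> F2 * p1\<^sup>2"
    unfolding q_def p1_def using x[OF i] heat_in_range[OF \<tau>(1) x i] by (rule f_taylor)
  also have "\<dots> \<le> F2 * ((\<alpha> * \<tau>) * G * \<beta>)\<^sup>2"
    using p1 F_nonneg by (intro mult_left_mono) (auto simp: abs_le_square_iff[symmetric])
  finally have q: "\<bar>q\<bar> \<le> F2 * ((\<alpha> * \<tau>) * G * \<beta>)\<^sup>2" .
  have f1p2: "\<bar>f1 (x i) * p2\<bar> \<le> F1 * ((\<alpha> * \<tau>) ^ 2 * G * \<beta>)"
    unfolding abs_mult using f1_bound[OF x[OF i]] p2 F_nonneg by (intro mult_mono) auto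
  have Lsum: "L (\<lambda>j. L x j + f (x j)) i = L (L x) i + L (\<lambda>j. f (x j)) i"
    using L_linear[of 1 "L x" 1 "\<lambda>j. f (x j)"] by simp
  \<comment> \<open>Since the average minus \<open>x i\<close> equals
    \<open>\<tau> * L x i + p2\<close>, the remainder of \<open>f\<close> at the average is
    \<open>q + f1 (x i) * p2\<close>; \<open>p1\<close> enters only through the bound on
    \<open>q\<close>. Each summand is of order \<open>\<tau>^3\<close>.\<close>
  have "step \<tau> x i - (x i + \<tau> * (L x i + f (x i))
      + \<tau>\<^sup>2 / 2 * (L (\<lambda>j. L x j + f (x j)) i + f1 (x i) * (L x i + f (x i))))
      = r3 + \<tau> / 2 * r2 + \<tau> / 2 * q + \<tau> / 2 * (f1 (x i) * p2) + \<tau>\<^sup>2 / 2 * r1"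
    unfolding step_def Lsum r3_def r2_def r1_def q_def p2_def
    by (simp add: field_simps power2_eq_square)
  moreover have "\<bar>\<tau> / 2 * p\<bar> \<le> \<tau> / 2 * B" "\<bar>\<tau>\<^sup>2 / 2 * p\<bar> \<le> \<tau>\<^sup>2 / 2 * B" if "\<bar>p\<bar> \<le> B" for p B
    using \<tau> that by (auto simp: abs_mult intro!: mult_left_mono)
  note this(1)[OF r2] this(1)[OF q] this(1)[OF f1p2] this(2)[OF r1]
  ultimately have "\<bar>step \<tau> x i - (x i + \<tau> * (L x i + f (x i))
      + \<tau>\<^sup>2 / 2 * (L (\<lambda>j. L x j + f (x j)) i + f1 (x i) * (L x i + f (x i))))\<bar>
      \<le> (\<alpha> * \<tau>) ^ 3 * G * \<beta> + \<tau> / 2 * ((\<alpha> * \<tau>) ^ 2 * G * F0)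
        + \<tau> / 2 * (F2 * ((\<alpha> * \<tau>) * G * \<beta>)\<^sup>2) + \<tau> / 2 * (F1 * ((\<alpha> * \<tau>) ^ 2 * G * \<beta>))
        + \<tau>\<^sup>2 / 2 * ((\<alpha> * \<tau>) * G * (F1 * F0))"
    using r3 by linarith
  also have "\<dots> = \<tau> ^ 3 * expansion_const G \<alpha> \<beta> F0 F1 F2"
    unfolding expansion_const_def by (simp add: field_simps power2_eq_square power3_eq_cube)
  finally show ?thesis unfolding G_def .
qed

text \<open>The equation can be differentiated twice: the third time derivative \<open>d3\<close>
  contains \<open>f2\<close> but no higher derivative of \<open>f\<close>, and all bounds follow
  recursively from the bound \<beta> on the solution.\<close>

lemma solution_taylor:
  fixes u :: "real \<Rightarrow> nat \<Rightarrow> real"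
  assumes ode: "\<And>i t. i < N \<Longrightarrow> t \<in> {0..T} \<Longrightarrow>
      ((\<lambda>s. u s i) has_real_derivative L (u t) i + f (u t i)) (at t within {0..T})"
    and range: "\<And>i t. i < N \<Longrightarrow> t \<in> {0..T} \<Longrightarrow> u t i \<in> {-\<beta>..\<beta>}"
    and t: "t \<in> {0..T}" "t + \<tau> \<in> {0..T}" "0 \<le> \<tau>" and i: "i < N"
  shows "\<bar>u (t + \<tau>) i - (u t i + \<tau> * (L (u t) i + f (u t i))
      + \<tau>\<^sup>2 / 2 * (L (\<lambda>j. L (u t) j + f (u t j)) i + f1 (u t i) * (L (u t) i + f (u t i))))\<bar>
    \<le> \<tau> ^ 3 * (taylor_const \<alpha> \<beta> F0 F1 F2 / 2)"
proof -
  let ?S = "{0..T}"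
  define d1 where "d1 s i = L (u s) i + f (u s i)" for s i
  define d2 where "d2 s i = L (d1 s) i + f1 (u s i) * d1 s i" for s i
  define d3 where "d3 s i = L (d2 s) i + (f2 (u s i) * d1 s i * d1 s i + f1 (u s i) * d2 s i)" for s i
  have L_deriv: "((\<lambda>s. L (v s) i) has_real_derivative L w i) (at s within ?S)"
    if "\<And>j. j < N \<Longrightarrow> ((\<lambda>s. v s j) has_real_derivative w j) (at s within ?S)" for v w s i
    unfolding L_def using that by (intro DERIV_sum DERIV_cmult) auto
  have u': "((\<lambda>s. u s i) has_real_derivative d1 s i) (at s within ?S)" if "i < N" "s \<in> ?S" for i s
    unfolding d1_def by (rule ode[OF that])
  \<comment> \<open>As \<open>f\<close> and \<open>f1\<close> are differentiable only relative to
    the interval, the chain rule is used with the derivative within the image of the solution, which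
    \<open>range\<close> places there.\<close>
  have chain: "((\<lambda>s. g (u s i)) has_real_derivative g' (u s i) * d1 s i) (at s within ?S)"
    if g: "\<And>y. y \<in> {-\<beta>..\<beta>} \<Longrightarrow> (g has_real_derivative g' y) (at y within {-\<beta>..\<beta>})"
      and "i < N" "s \<in> ?S" for g g' i s
  proof -
    have "(g has_real_derivative g' (u s i)) (at (u s i) within (\<lambda>s. u s i) ` ?S)"
      by (rule DERIV_subset[OF g]) (use range that in auto)
    from DERIV_image_chain[OF this u'[OF that(2,3)]] show ?thesis by (simp add: o_def)
  qed
  have d1': "((\<lambda>s. d1 s i) has_real_derivative d2 s i) (at s within ?S)" if "i < N" "s \<in> ?S" for i s
  proof -
    have "((\<lambda>s. L (u s) i + f (u s i)) has_real_derivative L (d1 s) i + f1 (u s i) * d1 s i)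
        (at s within ?S)"
      by (intro DERIV_add L_deriv u' chain[of f f1] f_deriv that)
    then show ?thesis unfolding d2_def d1_def .
  qed
  have d2': "((\<lambda>s. d2 s i) has_real_derivative d3 s i) (at s within ?S)" if "i < N" "s \<in> ?S" for i s
  proof -
    have "((\<lambda>s. L (d1 s) i + f1 (u s i) * d1 s i) has_real_derivative d3 s i) (at s within ?S)"
      unfolding d3_def
      by (rule DERIV_add[OF L_deriv DERIV_cong[OF DERIV_mult[OF chain[of f1 f2] d1']]])
         (use d1' f1_deriv that in \<open>auto simp: algebra_simps\<close>)
    then show ?thesis unfolding d2_def .
  qed
  let ?D1 = "\<alpha> * \<beta> + F0" and ?D2 = "(\<alpha> + F1) * (\<alpha> * \<beta> + F0)"
  have D1: "0 \<le> ?D1" using norm_nonneg beta_pos F_nonneg by simp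
  have b1: "\<bar>d1 s i\<bar> \<le> ?D1" if "i < N" "s \<in> ?S" for i s
  proof -
    have "\<bar>L (u s) i\<bar> \<le> \<alpha> * \<beta>"
      using range that by (intro L_bound) (fastforce simp: abs_le_iff)+
    moreover have "\<bar>f (u s i)\<bar> \<le> F0" using range that by (intro f_bound)
    ultimately show ?thesis unfolding d1_def by linarith
  qed
  have f1m: "\<bar>f1 (u s i) * p\<bar> \<le> F1 * B" if "\<bar>p\<bar> \<le> B" "i < N" "s \<in> ?S" for p B i s
    unfolding abs_mult using f1_bound[OF range[OF that(2,3)]] that(1) F_nonneg
    by (intro mult_mono) auto
  have b2: "\<bar>d2 s i\<bar> \<le> ?D2" if "i < N" "s \<in> ?S" for i s
  proof -
    have "\<bar>L (d1 s) i\<bar> \<le> \<alpha> * ?D1" using b1 that by (intro L_bound) auto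
    with f1m[OF b1[OF that] that] show ?thesis unfolding d2_def by (simp only: distrib_right)
  qed
  have b3: "\<bar>d3 s i\<bar> \<le> taylor_const \<alpha> \<beta> F0 F1 F2" if "i < N" "s \<in> ?S" for i s
  proof -
    have "\<bar>L (d2 s) i\<bar> \<le> \<alpha> * ?D2" using b2 that by (intro L_bound) auto
    moreover have "\<bar>f2 (u s i) * d1 s i * d1 s i\<bar> \<le> F2 * ?D1 * ?D1"
      unfolding abs_mult using f2_bound[OF range[OF that]] b1[OF that] F_nonneg D1
      by (intro mult_mono mult_nonneg_nonneg) auto
    ultimately have "\<bar>d3 s i\<bar> \<le> \<alpha> * ?D2 + (F2 * ?D1 * ?D1 + F1 * ?D2)"
      using f1m[OF b2[OF that] that] unfolding d3_def by linarith
    also have "\<dots> = taylor_const \<alpha> \<beta> F0 F1 F2"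
      unfolding taylor_const_def by (simp add: algebra_simps power2_eq_square)
    finally show ?thesis .
  qed
  \<comment> \<open>The remainder in \<open>field_Taylor\<close> of order 2 is divided by
    \<open>fact 2\<close> rather than \<open>fact 3\<close>; this is where
    \<open>taylor_const\<close> acquires the factor 1 / 2.\<close>
  define D where "D k s = [u s i, d1 s i, d2 s i, d3 s i] ! k" for k s
  have "norm (D 0 (t + \<tau>) - (\<Sum>k\<le>2. D k t * (t + \<tau> - t) ^ k / fact k))
      \<le> taylor_const \<alpha> \<beta> F0 F1 F2 * norm (t + \<tau> - t) ^ Suc 2 / fact 2"
  proof (rule field_Taylor[of ?S 2 D])
    fix k :: nat and s assume "s \<in> ?S" "k \<le> 2"
    then consider "k = 0" | "k = 1" | "k = 2" by linarith
    then show "(D k has_real_derivative D (Suc k) s) (at s within ?S)"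
      using u'[OF i \<open>s \<in> ?S\<close>] d1'[OF i \<open>s \<in> ?S\<close>] d2'[OF i \<open>s \<in> ?S\<close>]
      by cases (auto simp: D_def[abs_def] eval_nat_numeral)
  qed (use t b3[OF i] in \<open>auto simp: D_def eval_nat_numeral\<close>)
  moreover have "(\<Sum>k\<le>2. D k t * (t + \<tau> - t) ^ k / fact k) = u t i + \<tau> * d1 t i + \<tau>\<^sup>2 / 2 * d2 t i"
    by (simp add: D_def eval_nat_numeral)
  moreover have "d1 t = (\<lambda>j. L (u t) j + f (u t j))" by (simp add: d1_def[abs_def])
  ultimately show ?thesis
    using t(3) by (simp add: D_def d2_def eval_nat_numeral mult.commute)
qed

lemma local_error:
  fixes u :: "real \<Rightarrow> nat \<Rightarrow> real"
  assumes ode: "\<And>i t. i < N \<Longrightarrow> t \<in> {0..T} \<Longrightarrow>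
      ((\<lambda>s. u s i) has_real_derivative L (u t) i + f (u t i)) (at t within {0..T})"
    and range: "\<And>i t. i < N \<Longrightarrow> t \<in> {0..T} \<Longrightarrow> u t i \<in> {-\<beta>..\<beta>}"
    and t: "t \<in> {0..T}" "t + \<tau> \<in> {0..T}" and \<tau>: "0 \<le> \<tau>" "\<tau> \<le> \<sigma>" and i: "i < N"
  shows "\<bar>step \<tau> (u t) i - u (t + \<tau>) i\<bar>
    \<le> \<tau> ^ 3 * (taylor_const \<alpha> \<beta> F0 F1 F2 / 2 + expansion_const (exp (\<alpha> * \<sigma>)) \<alpha> \<beta> F0 F1 F2)"
proof -
  let ?z = "u t i + \<tau> * (L (u t) i + f (u t i))
      + \<tau>\<^sup>2 / 2 * (L (\<lambda>j. L (u t) j + f (u t j)) i + f1 (u t i) * (L (u t) i + f (u t i)))"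
  have "\<bar>u (t + \<tau>) i - ?z\<bar> \<le> \<tau> ^ 3 * (taylor_const \<alpha> \<beta> F0 F1 F2 / 2)"
    by (rule solution_taylor[OF ode range t \<tau>(1) i])
  moreover have "\<bar>step \<tau> (u t) i - ?z\<bar> \<le> \<tau> ^ 3 * expansion_const (exp (\<alpha> * \<sigma>)) \<alpha> \<beta> F0 F1 F2"
    by (rule step_expansion[OF \<tau> range[OF _ t(1)] i])
  ultimately show ?thesis unfolding distrib_left[of "\<tau> ^ 3"] by linarith
qed

text \<open>Range and error are carried together because \<open>step_stable\<close> is available
  only inside the interval. The condition on \<open>K\<close> makes \<open>K * \<gamma>\<close>
  dominate the local error constant.\<close>

lemma global_error:
  fixes u :: "real \<Rightarrow> nat \<Rightarrow> real" and U :: "nat \<Rightarrow> nat \<Rightarrow> real"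
  assumes ode: "\<And>i t. i < N \<Longrightarrow> t \<in> {0..T} \<Longrightarrow>
      ((\<lambda>s. u s i) has_real_derivative L (u t) i + f (u t i)) (at t within {0..T})"
    and range: "\<And>i t. i < N \<Longrightarrow> t \<in> {0..T} \<Longrightarrow> u t i \<in> {-\<beta>..\<beta>}"
    and U0: "\<And>i. i < N \<Longrightarrow> U 0 i = u 0 i"
    and U: "\<And>m i. m < M \<Longrightarrow> i < N \<Longrightarrow> U (Suc m) i = step \<tau> (U m) i"
    and \<tau>: "0 \<le> \<tau>" "\<tau> \<le> \<sigma>" "real M * \<tau> \<le> T"
    and f1_lower: "\<And>x. x \<in> {-\<beta>..\<beta>} \<Longrightarrow> - \<kappa> \<le> f1 x"
    and f2f_lower: "\<And>x. x \<in> {-\<beta>..\<beta>} \<Longrightarrow> - w \<le> f2 x * f x"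
    and small: "\<tau> * \<kappa> \<le> 1" "\<tau> * \<kappa> + \<tau>\<^sup>2 * w \<le> 7 / 4"
    and \<gamma>: "0 < \<gamma>" "\<gamma> = F1 + \<sigma> * F3 / 2"
    and K: "taylor_const \<alpha> \<beta> F0 F1 F2 / 2 + expansion_const (exp (\<alpha> * \<sigma>)) \<alpha> \<beta> F0 F1 F2 \<le> K * \<gamma>"
    and "m \<le> M" "i < N"
  shows "\<bar>U m i - u (real m * \<tau>) i\<bar> \<le> K * (exp (\<gamma> * (real m * \<tau>)) - 1) * \<tau>\<^sup>2"
proof -
  have mt: "real m * \<tau> \<in> {0..T}" if "m \<le> M" for m
    using mult_right_mono[of "real m" "real M" \<tau>] that \<tau> by auto
  define e where "e m = K * (exp (\<gamma> * (real m * \<tau>)) - 1) * \<tau>\<^sup>2" for m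
  have "\<forall>i<N. U m i \<in> {-\<beta>..\<beta>} \<and> \<bar>U m i - u (real m * \<tau>) i\<bar> \<le> e m" using \<open>m \<le> M\<close>
  proof (induction m)
    case 0
    then show ?case using U0 range[of _ 0] mt[of 0] by (auto simp: e_def)
  next
    case (Suc m)
    then have IH: "\<And>i. i < N \<Longrightarrow> U m i \<in> {-\<beta>..\<beta>}"
      "\<And>i. i < N \<Longrightarrow> \<bar>U m i - u (real m * \<tau>) i\<bar> \<le> e m" and m: "m < M" "m \<le> M" by auto
    show ?case
    proof (intro allI impI conjI)
      fix i assume i: "i < N"
      show "U (Suc m) i \<in> {-\<beta>..\<beta>}"
        unfolding U[OF m(1) i]
        by (rule step_max_principle[OF \<tau>(1) f1_lower f2f_lower small IH(1) i])
      have e: "0 \<le> e m" using IH(2)[OF i] by linarith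
      have "\<bar>step \<tau> (U m) i - step \<tau> (u (real m * \<tau>)) i\<bar> \<le> (1 + \<tau> * F1 + \<tau>\<^sup>2 / 2 * F3) * e m"
        using range mt[OF m(2)] by (intro step_stable[OF \<tau>(1) IH(1) _ IH(2) i])
      also have "\<dots> \<le> (1 + \<tau> * \<gamma>) * e m"
      proof (intro mult_right_mono e)
        \<comment> \<open>One of the two factors \<tau> is replaced by the largest step \<sigma>,
          which produces the summand \<open>\<sigma> * F3 / 2\<close> of \<gamma>.\<close>
        have "\<tau> * \<tau> * F3 \<le> \<tau> * \<sigma> * F3"
          using \<tau> F_nonneg by (intro mult_right_mono mult_left_mono)
        then show "1 + \<tau> * F1 + \<tau>\<^sup>2 / 2 * F3 \<le> 1 + \<tau> * \<gamma>"
          unfolding \<gamma>(2) by (simp add: algebra_simps power2_eq_square)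
      qed
      finally have 1: "\<bar>step \<tau> (U m) i - step \<tau> (u (real m * \<tau>)) i\<bar> \<le> (1 + \<tau> * \<gamma>) * e m" .
      have Suc_m: "real (Suc m) * \<tau> = real m * \<tau> + \<tau>" by (simp add: algebra_simps)
      have "\<bar>step \<tau> (u (real m * \<tau>)) i - u (real (Suc m) * \<tau>) i\<bar> \<le> \<tau> ^ 3 *
          (taylor_const \<alpha> \<beta> F0 F1 F2 / 2 + expansion_const (exp (\<alpha> * \<sigma>)) \<alpha> \<beta> F0 F1 F2)"
        using mt[OF m(2)] mt[OF Suc.prems] unfolding Suc_m
        by (intro local_error[OF ode range _ _ \<tau>(1,2) i])
      also have "\<dots> \<le> \<tau> ^ 3 * (K * \<gamma>)" using K \<tau> by (intro mult_left_mono) auto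
      finally have "\<bar>U (Suc m) i - u (real (Suc m) * \<tau>) i\<bar> \<le> (1 + \<tau> * \<gamma>) * e m + \<tau> ^ 3 * (K * \<gamma>)"
        using 1 unfolding U[OF m(1) i] by linarith
      \<comment> \<open>The subtracted 1 absorbs the local error exactly:
        \<open>(1 + y) (E - 1) + y = (1 + y) E - 1\<close> with
        \<open>y = \<tau> * \<gamma>\<close>.\<close>
      also have "\<dots> = K * \<tau>\<^sup>2 * ((1 + \<tau> * \<gamma>) * exp (\<gamma> * (real m * \<tau>)) - 1)"
        by (simp add: e_def algebra_simps power2_eq_square power3_eq_cube)
      also have "\<dots> \<le> K * \<tau>\<^sup>2 * (exp (\<tau> * \<gamma>) * exp (\<gamma> * (real m * \<tau>)) - 1)"
      proof (intro mult_left_mono diff_right_mono mult_right_mono exp_ge_add_one_self)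
        have "0 \<le> taylor_const \<alpha> \<beta> F0 F1 F2" "0 \<le> expansion_const (exp (\<alpha> * \<sigma>)) \<alpha> \<beta> F0 F1 F2"
          using norm_nonneg beta_pos F_nonneg by (simp_all add: taylor_const_def expansion_const_def)
        then have "0 \<le> K * \<gamma>" using K by linarith
        then show "0 \<le> K * \<tau>\<^sup>2" using \<gamma>(1) by (simp add: zero_le_mult_iff)
      qed auto
      also have "\<dots> = e (Suc m)"
        by (simp add: e_def algebra_simps flip: exp_add)
      finally show "\<bar>U (Suc m) i - u (real (Suc m) * \<tau>) i\<bar> \<le> e (Suc m)" .
    qed
  qed
  then show ?thesis using \<open>i < N\<close> by (simp add: e_def)
qed

end

subsection \<open>Discrete Laplacians are rate matrices\<close>

text \<open>These conditions are preserved by sums, nonnegative multiples and Kronecker products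
  with identities. The operator bound of \<open>rate_matrix\<close> is supplied separately by
  \<open>mat_maxnorm\<close>.\<close>

definition rate_mat :: "nat \<Rightarrow> real mat \<Rightarrow> bool" where
  "rate_mat n A \<longleftrightarrow> A \<in> carrier_mat n n \<and> (\<forall>i<n. \<forall>j<n. i \<noteq> j \<longrightarrow> 0 \<le> A $$ (i, j)) \<and>
     (\<forall>i<n. (\<Sum>j<n. A $$ (i, j)) = 0)"

lemma rate_mat_add: "rate_mat n A \<Longrightarrow> rate_mat n B \<Longrightarrow> rate_mat n (A + B)"
  by (auto simp: rate_mat_def sum.distrib)

lemma rate_mat_smult: "rate_mat n A \<Longrightarrow> 0 \<le> c \<Longrightarrow> rate_mat n (smult_mat c A)"
  by (auto simp: rate_mat_def simp flip: sum_distrib_left)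

text \<open>As a sum of three terms, each supported at one column at most, the row sum collapses at
  once. For \<open>i = 0\<close> the truncated \<open>i - 1\<close> is the diagonal column, so the
  third term needs the coefficient 0 there.\<close>

lemma neumann_laplacian_entry:
  assumes "i < n" "j < n" "2 \<le> n"
  shows "neumann_laplacian h n $$ (i, j) = 1 / h\<^sup>2 * ((if j = i then -2 else 0)
    + (if j = Suc i then (if i = 0 then 2 else 1) else 0)
    + (if j = i - 1 then (if i = 0 then 0 else if i = n - 1 then 2 else 1) else 0))"
  using assms by (auto simp: neumann_laplacian_def)

lemma rate_mat_neumann_laplacian:
  assumes "2 \<le> n"
  shows "rate_mat n (neumann_laplacian h n)"
  unfolding rate_mat_def
proof (intro conjI allI impI)
  show "neumann_laplacian h n \<in> carrier_mat n n" by (simp add: neumann_laplacian_def)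
next
  fix i j assume "i < n" "j < n" "i \<noteq> j"
  then show "0 \<le> neumann_laplacian h n $$ (i, j)" using assms by (simp add: neumann_laplacian_entry)
next
  fix i assume "i < n"
  then have "(\<Sum>j<n. neumann_laplacian h n $$ (i, j)) = 1 / h\<^sup>2 * (-2
      + (if Suc i < n then (if i = 0 then 2 else 1) else 0)
      + (if i = 0 then 0 else if i = n - 1 then 2 else 1))"
    using assms by (simp add: neumann_laplacian_entry sum.distrib flip: sum_distrib_left sum_divide_distrib)
  then show "(\<Sum>j<n. neumann_laplacian h n $$ (i, j)) = 0"
    using \<open>i < n\<close> assms by (auto split: if_splits)
qed

section \<open>Kronecker products with identity matrices\<close>

lemma dim_kronecker [simp]:
  "dim_row (A \<otimes>\<^sub>k B) = dim_row A * dim_row B" "dim_col (A \<otimes>\<^sub>k B) = dim_col A * dim_col B"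
  by (simp_all add: kronecker_def)

text \<open>Splitting the column index into quotient and remainder factors the sum, so a single
  factor with vanishing row sums is enough.\<close>

lemma kronecker_row_sum:
  assumes A: "A \<in> carrier_mat n n" and B: "B \<in> carrier_mat m m" and i: "i < n * m"
  shows "(\<Sum>j<n * m. (A \<otimes>\<^sub>k B) $$ (i, j)) = (\<Sum>j<n. A $$ (i div m, j)) * (\<Sum>j<m. B $$ (i mod m, j))"
proof -
  have "(\<Sum>j<n * m. (A \<otimes>\<^sub>k B) $$ (i, j)) = (\<Sum>j<n * m. A $$ (i div m, j div m) * B $$ (i mod m, j mod m))"
    using A B i by (intro sum.cong) (auto simp: kronecker_def)
  also have "\<dots> = (\<Sum>p<n. \<Sum>q<m. A $$ (i div m, p) * B $$ (i mod m, q))"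
    unfolding sum_mult_product by (intro sum.cong) auto
  finally show ?thesis by (simp add: sum_product)
qed

lemma rate_mat_one_kronecker:
  assumes "rate_mat m A"
  shows "rate_mat (n * m) (1\<^sub>m n \<otimes>\<^sub>k A)"
proof -
  have A: "A \<in> carrier_mat m m" and off: "\<And>i j. \<lbrakk>i < m; j < m; i \<noteq> j\<rbrakk> \<Longrightarrow> 0 \<le> A $$ (i, j)"
    and row: "\<And>i. i < m \<Longrightarrow> (\<Sum>j<m. A $$ (i, j)) = 0"
    using assms by (auto simp: rate_mat_def)
  show ?thesis
    unfolding rate_mat_def
  proof (intro conjI allI impI)
    show "1\<^sub>m n \<otimes>\<^sub>k A \<in> carrier_mat (n * m) (n * m)" using A by (auto simp: kronecker_def)
  next
    fix i j assume ij: "i < n * m" "j < n * m" "i \<noteq> j"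
    then have "0 < m" by (cases m) auto
    then have "i mod m < m" "j mod m < m" "i div m < n" "j div m < n"
      using ij by (auto simp: less_mult_imp_div_less)
    \<comment> \<open>A nonzero entry requires equal quotients. Distinct indices then differ in the
      remainder, so the entry of \<open>A\<close> involved is off its diagonal.\<close>
    moreover have "i mod m \<noteq> j mod m" if "i div m = j div m"
      using that ij(3) by (metis div_mult_mod_eq)
    ultimately show "0 \<le> (1\<^sub>m n \<otimes>\<^sub>k A) $$ (i, j)" using A ij off by (auto simp: kronecker_def)
  next
    fix i assume i: "i < n * m"
    then have "i mod m < m" by (cases m) auto
    then show "(\<Sum>j<n * m. (1\<^sub>m n \<otimes>\<^sub>k A) $$ (i, j)) = 0"
      using kronecker_row_sum[OF one_carrier_mat A i] row by simp
  qed
qed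

lemma rate_mat_kronecker_one:
  assumes "rate_mat m A"
  shows "rate_mat (m * n) (A \<otimes>\<^sub>k 1\<^sub>m n)"
proof -
  have A: "A \<in> carrier_mat m m" and off: "\<And>i j. \<lbrakk>i < m; j < m; i \<noteq> j\<rbrakk> \<Longrightarrow> 0 \<le> A $$ (i, j)"
    and row: "\<And>i. i < m \<Longrightarrow> (\<Sum>j<m. A $$ (i, j)) = 0"
    using assms by (auto simp: rate_mat_def)
  show ?thesis
    unfolding rate_mat_def
  proof (intro conjI allI impI)
    show "A \<otimes>\<^sub>k 1\<^sub>m n \<in> carrier_mat (m * n) (m * n)" using A by (auto simp: kronecker_def)
  next
    fix i j assume ij: "i < m * n" "j < m * n" "i \<noteq> j"
    then have "0 < n" by (cases n) auto
    then have "i mod n < n" "j mod n < n" "i div n < m" "j div n < m"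
      using ij by (auto simp: less_mult_imp_div_less)
    moreover have "i div n \<noteq> j div n" if "i mod n = j mod n"
      using that ij(3) by (metis div_mult_mod_eq)
    ultimately show "0 \<le> (A \<otimes>\<^sub>k 1\<^sub>m n) $$ (i, j)" using A ij off by (auto simp: kronecker_def)
  next
    fix i assume i: "i < m * n"
    then have "i div n < m" by (simp add: less_mult_imp_div_less)
    then show "(\<Sum>j<m * n. (A \<otimes>\<^sub>k 1\<^sub>m n) $$ (i, j)) = 0"
      using kronecker_row_sum[OF A one_carrier_mat i] row by simp
  qed
qed

text \<open>\<open>\<otimes>\<^sub>k\<close> associates to the left, so in three dimensions the
  first summand starts with a product of two identities, which has to be merged into one.\<close>

lemma kronecker_one_one: "1\<^sub>m n \<otimes>\<^sub>k 1\<^sub>m m = (1\<^sub>m (n * m) :: real mat)"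
proof (rule eq_matI)
  fix i j assume "i < dim_row (1\<^sub>m (n * m) :: real mat)" "j < dim_col (1\<^sub>m (n * m) :: real mat)"
  then have ij: "i < n * m" "j < n * m" by auto
  then have "0 < m" by (cases m) auto
  then have "i mod m < m" "j mod m < m" "i div m < n" "j div m < n"
    using ij by (auto simp: less_mult_imp_div_less)
  moreover have "i = j \<longleftrightarrow> i div m = j div m \<and> i mod m = j mod m"
    by (metis div_mult_mod_eq)
  ultimately show "(1\<^sub>m n \<otimes>\<^sub>k 1\<^sub>m m) $$ (i, j) = (1\<^sub>m (n * m) :: real mat) $$ (i, j)"
    using ij by (auto simp: kronecker_def)
qed auto

lemma rate_mat_discrete_laplacian:
  assumes "uniform_grid a b ns h"
  shows "rate_mat (prod_list ns) (discrete_laplacian h ns)" "0 < prod_list ns"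
proof -
  have len: "length ns = 1 \<or> length ns = 2 \<or> length ns = 3" and ge: "\<And>k. k < length ns \<Longrightarrow> 2 \<le> ns ! k"
    using assms by (auto simp: uniform_grid_def)
  note rate = rate_mat_neumann_laplacian rate_mat_one_kronecker rate_mat_kronecker_one
  have *: "rate_mat (prod_list ns) (discrete_laplacian h ns) \<and> 0 < prod_list ns"
    using len
  proof (elim disjE)
    assume "length ns = 1"
    then obtain n1 where ns: "ns = [n1]" by (auto simp: length_Suc_conv)
    then show ?thesis using ge[of 0] by (auto simp: discrete_laplacian_def intro: rate)
  next
    assume "length ns = 2"
    then obtain n1 n2 where ns: "ns = [n1, n2]" by (auto simp: length_Suc_conv numeral_2_eq_2)
    then have n: "2 \<le> n1" "2 \<le> n2" using ge[of 0] ge[of 1] by auto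
    \<comment> \<open>The first coordinate varies fastest and is thus the rightmost Kronecker
      factor, so the dimensions appear in reverse order of \<open>ns\<close>.\<close>
    have "rate_mat (n2 * n1) (1\<^sub>m n2 \<otimes>\<^sub>k neumann_laplacian h n1 + neumann_laplacian h n2 \<otimes>\<^sub>k 1\<^sub>m n1)"
      using n by (intro rate_mat_add rate)
    then show ?thesis using n ns by (simp add: discrete_laplacian_def mult.commute)
  next
    assume "length ns = 3"
    then obtain n1 n2 n3 where ns: "ns = [n1, n2, n3]"
      by (auto simp: length_Suc_conv numeral_3_eq_3)
    then have n: "2 \<le> n1" "2 \<le> n2" "2 \<le> n3" using ge[of 0] ge[of 1] ge[of 2] by auto
    have "rate_mat (n3 * n2 * n1) (1\<^sub>m n3 \<otimes>\<^sub>k 1\<^sub>m n2 \<otimes>\<^sub>k neumann_laplacian h n1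
       + 1\<^sub>m n3 \<otimes>\<^sub>k neumann_laplacian h n2 \<otimes>\<^sub>k 1\<^sub>m n1
       + neumann_laplacian h n3 \<otimes>\<^sub>k 1\<^sub>m n2 \<otimes>\<^sub>k 1\<^sub>m n1)"
      using n unfolding kronecker_one_one by (intro rate_mat_add rate)
    then show ?thesis using n ns by (simp add: discrete_laplacian_def mult_ac)
  qed
  then show "rate_mat (prod_list ns) (discrete_laplacian h ns)" "0 < prod_list ns" by auto
qed

section \<open>Maximum norms of vectors and matrices\<close>

lemma vec_maxnorm_le_iff: "0 < dim_vec v \<Longrightarrow> vec_maxnorm v \<le> B \<longleftrightarrow> (\<forall>i<dim_vec v. \<bar>v $ i\<bar> \<le> B)"
  unfolding vec_maxnorm_def by (subst Max_le_iff) auto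

lemma vec_maxnorm_ge: "i < dim_vec v \<Longrightarrow> \<bar>v $ i\<bar> \<le> vec_maxnorm v"
  using vec_maxnorm_le_iff[of v "vec_maxnorm v"] by auto

lemma mat_maxnorm_bound:
  assumes A: "A \<in> carrier_mat N N" and "0 < N"
  shows "0 \<le> mat_maxnorm A"
    and "\<lbrakk>\<And>j. j < N \<Longrightarrow> \<bar>x j\<bar> \<le> B; i < N\<rbrakk> \<Longrightarrow> \<bar>\<Sum>j<N. A $$ (i, j) * x j\<bar> \<le> mat_maxnorm A * B"
proof -
  define S where "S = {v :: real Matrix.vec. dim_vec v = dim_col A \<and> v \<noteq> 0\<^sub>v (dim_col A)}"
  define r where "r v = vec_maxnorm (A *\<^sub>v v) / vec_maxnorm v" for v
  \<comment> \<open>A crude bound that depends on the dimension. It serves only to show that the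
    supremum in \<open>mat_maxnorm\<close> is over a bounded set, and does not enter the
    estimates.\<close>
  define R where "R = (\<Sum>i<N. \<Sum>j<N. \<bar>A $$ (i, j)\<bar>)"
  have pos: "0 < vec_maxnorm v" if "v \<in> S" for v
  proof -
    have "v = 0\<^sub>v (dim_vec v)" if "\<forall>i<dim_vec v. v $ i = 0" using that by (intro eq_vecI) auto
    then obtain i where "i < dim_vec v" "v $ i \<noteq> 0"
      using \<open>v \<in> S\<close> by (auto simp: S_def)
    then show ?thesis using vec_maxnorm_ge[of i v] by auto
  qed
  have Av: "(A *\<^sub>v v) $ i = (\<Sum>j<N. A $$ (i, j) * v $ j)" if "i < N" "dim_vec v = N" for i v
    using A that by (auto simp: scalar_prod_def lessThan_atLeast0)
  have le_R: "r v \<le> R" if v: "v \<in> S" for v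
  proof -
    have dv: "dim_vec v = N" using v A by (auto simp: S_def)
    have "vec_maxnorm (A *\<^sub>v v) \<le> R * vec_maxnorm v"
    proof (subst vec_maxnorm_le_iff)
      show "\<forall>i<dim_vec (A *\<^sub>v v). \<bar>(A *\<^sub>v v) $ i\<bar> \<le> R * vec_maxnorm v"
      proof (intro allI impI)
        fix i assume "i < dim_vec (A *\<^sub>v v)"
        then have i: "i < N" using A by auto
        have "\<bar>\<Sum>j<N. A $$ (i, j) * v $ j\<bar> \<le> (\<Sum>j<N. \<bar>A $$ (i, j)\<bar> * vec_maxnorm v)"
          using dv by (intro order.trans[OF sum_abs] sum_mono)
            (auto simp: abs_mult intro!: mult_left_mono vec_maxnorm_ge)
        also have "\<dots> = (\<Sum>j<N. \<bar>A $$ (i, j)\<bar>) * vec_maxnorm v" by (simp add: sum_distrib_right)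
        also have "\<dots> \<le> R * vec_maxnorm v"
          unfolding R_def using i pos[OF v] by (intro mult_right_mono member_le_sum[of i]) (auto intro: sum_nonneg)
        finally show "\<bar>(A *\<^sub>v v) $ i\<bar> \<le> R * vec_maxnorm v" using Av[OF i dv] by simp
      qed
    qed (use A \<open>0 < N\<close> in auto)
    then show ?thesis using pos[OF v] by (simp add: r_def divide_le_eq)
  qed
  then have bdd: "bdd_above (r ` S)" by (rule bdd_aboveI2)
  have norm: "mat_maxnorm A = Sup (r ` S)" by (simp add: mat_maxnorm_def S_def r_def)
  have up: "r v \<le> mat_maxnorm A" if "v \<in> S" for v
    unfolding norm using that bdd by (rule cSUP_upper)
  \<comment> \<open>One nonzero vector suffices to make the supremum nonnegative, since it dominates
    the nonnegative quotient at that vector.\<close>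
  let ?one = "Matrix.vec N (\<lambda>_. 1 :: real)"
  have "?one \<noteq> 0\<^sub>v N" using \<open>0 < N\<close> by (metis index_vec index_zero_vec(1) zero_neq_one)
  then have one: "?one \<in> S" using A by (auto simp: S_def)
  have "0 \<le> vec_maxnorm (A *\<^sub>v ?one)"
    using vec_maxnorm_ge[of 0 "A *\<^sub>v ?one"] A \<open>0 < N\<close> by auto
  then have "0 \<le> r ?one" using pos[OF one] by (simp add: r_def)
  then show nonneg: "0 \<le> mat_maxnorm A" using up[OF one] by linarith
  assume xB: "\<And>j. j < N \<Longrightarrow> \<bar>x j\<bar> \<le> B" and i: "i < N"
  then have B: "0 \<le> B" by (meson abs_ge_zero order_trans)
  define v where "v = Matrix.vec N x"
  have dv: "dim_vec v = N" by (simp add: v_def)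
  show "\<bar>\<Sum>j<N. A $$ (i, j) * x j\<bar> \<le> mat_maxnorm A * B"
  proof (cases "v \<in> S")
    case True
    have "\<bar>\<Sum>j<N. A $$ (i, j) * x j\<bar> = \<bar>(A *\<^sub>v v) $ i\<bar>"
      using Av[OF i dv] by (simp add: v_def)
    also have "\<dots> \<le> vec_maxnorm (A *\<^sub>v v)" using A i by (intro vec_maxnorm_ge) auto
    also have "\<dots> \<le> mat_maxnorm A * vec_maxnorm v"
      using up[OF True] pos[OF True] by (simp add: r_def divide_le_eq)
    also have "\<dots> \<le> mat_maxnorm A * B"
      using nonneg xB \<open>0 < N\<close> by (intro mult_left_mono) (auto simp: vec_maxnorm_le_iff v_def)
    finally show ?thesis .
  next
    case False
    then have "v = 0\<^sub>v N" using A dv by (auto simp: S_def)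
    then have "x j = 0" if "j < N" for j using that by (metis index_vec index_zero_vec(1) v_def)
    then show ?thesis using nonneg B by simp
  qed
qed

subsection \<open>The error bound for the scheme\<close>

lemma rate_matrix_rate_mat:
  assumes "rate_mat N A" and "0 < N"
  shows "rate_matrix N (\<lambda>i j. A $$ (i, j)) (mat_maxnorm A)"
proof -
  have A: "A \<in> carrier_mat N N" using assms by (simp add: rate_mat_def)
  show ?thesis
  proof
    fix x :: "nat \<Rightarrow> real" and B i
    assume "\<And>j. j < N \<Longrightarrow> \<bar>x j\<bar> \<le> B" "i < N"
    then show "\<bar>\<Sum>j<N. A $$ (i, j) * x j\<bar> \<le> mat_maxnorm A * B"
      by (rule mat_maxnorm_bound(2)[OF A assms(2)])
  qed (use assms mat_maxnorm_bound(1)[OF A assms(2)] in \<open>auto simp: rate_mat_def\<close>)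
qed

section \<open>The matrix exponential acts as the semigroup\<close>

lemma (in rate_matrix) pow_mat_apply:
  assumes A: "A \<in> carrier_mat N N" and entry: "\<And>i j. \<lbrakk>i < N; j < N\<rbrakk> \<Longrightarrow> A $$ (i, j) = a i j"
    and i: "i < N"
  shows "(\<Sum>j<N. (smult_mat \<tau> A ^\<^sub>m k) $$ (i, j) * x j) = \<tau> ^ k * (L ^^ k) x i"
  using i
proof (induction k arbitrary: x)
  case 0
  then have "(\<Sum>j<N. (smult_mat \<tau> A ^\<^sub>m 0) $$ (i, j) * x j) = (\<Sum>j<N. if j = i then x j else 0)"
    using A by (intro sum.cong) auto
  then show ?case using 0 by simp
next
  case (Suc k)
  have P: "smult_mat \<tau> A ^\<^sub>m k \<in> carrier_mat N N" using A by (intro pow_carrier_mat smult_carrier_mat)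
  have "(\<Sum>j<N. (smult_mat \<tau> A ^\<^sub>m Suc k) $$ (i, j) * x j)
      = (\<Sum>j<N. (\<Sum>l<N. (smult_mat \<tau> A ^\<^sub>m k) $$ (i, l) * (\<tau> * a l j)) * x j)"
    using A P Suc.prems
    by (intro sum.cong) (auto simp: scalar_prod_def lessThan_atLeast0 entry)
  also have "\<dots> = (\<Sum>l<N. (smult_mat \<tau> A ^\<^sub>m k) $$ (i, l) * (\<tau> * L x l))"
    unfolding L_def sum_distrib_left sum_distrib_right by (subst sum.swap) (simp add: mult_ac)
  also have "\<dots> = \<tau> ^ k * (L ^^ k) (\<lambda>l. \<tau> * L x l) i"
    by (rule Suc.IH[OF Suc.prems])
  also have "(L ^^ k) (\<lambda>l. \<tau> * L x l) i = \<tau> * (L ^^ k) (L x) i"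
    using L_iter_linear[of k \<tau> "L x" 0 "\<lambda>_. 0"] by simp
  finally show ?case by (simp add: funpow_swap1)
qed

text \<open>\<open>mat_exp\<close> is a series in each entry, \<open>heat\<close> a series of
  vectors. A row is finite, so sum and series may be exchanged once every entry series
  converges.\<close>

lemma (in rate_matrix) mat_exp_apply:
  assumes A: "A \<in> carrier_mat N N" and entry: "\<And>i j. \<lbrakk>i < N; j < N\<rbrakk> \<Longrightarrow> A $$ (i, j) = a i j"
    and \<tau>: "0 \<le> \<tau>" and i: "i < N" and v: "dim_vec v = N"
  shows "(mat_exp (smult_mat \<tau> A) *\<^sub>v v) $ i = heat \<tau> (\<lambda>j. v $ j) i"
proof -
  let ?p = "\<lambda>k j. (smult_mat \<tau> A ^\<^sub>m k) $$ (i, j) / fact k"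
  have summable: "summable (\<lambda>k. ?p k j)" if j: "j < N" for j
  proof -
    \<comment> \<open>Applied to a unit vector, the matrix power returns its entry
      \<open>(i, j)\<close>, so convergence of the entry series is a case of
      \<open>heat_summable\<close>.\<close>
    let ?e = "\<lambda>l. if l = j then 1 else 0 :: real"
    have "(smult_mat \<tau> A ^\<^sub>m k) $$ (i, j) = \<tau> ^ k * (L ^^ k) ?e i" for k
      using pow_mat_apply[OF A entry i, where k = k and x = ?e and \<tau> = \<tau>] j
      by (simp add: if_distrib cong: if_cong)
    then show ?thesis using heat_summable[OF \<tau> i, of ?e] by simp
  qed
  have "(mat_exp (smult_mat \<tau> A) *\<^sub>v v) $ i = (\<Sum>j<N. (\<Sum>k. ?p k j) * v $ j)"
    using A i v by (simp add: mat_exp_def scalar_prod_def lessThan_atLeast0)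
  also have "\<dots> = (\<Sum>j<N. \<Sum>k. ?p k j * v $ j)"
    by (intro sum.cong refl suminf_mult2 summable) auto
  also have "\<dots> = (\<Sum>k. \<Sum>j<N. ?p k j * v $ j)"
    by (intro suminf_sum[symmetric] summable_mult2 summable) auto
  also have "(\<lambda>k. \<Sum>j<N. ?p k j * v $ j) = (\<lambda>k. \<tau> ^ k / fact k * (L ^^ k) (\<lambda>j. v $ j) i)"
  proof
    fix k
    show "(\<Sum>j<N. ?p k j * v $ j) = \<tau> ^ k / fact k * (L ^^ k) (\<lambda>j. v $ j) i"
      using pow_mat_apply[OF A entry i, where k = k and x = "\<lambda>j. v $ j" and \<tau> = \<tau>]
      by (simp flip: sum_divide_distrib)
  qed
  finally show ?thesis by (simp add: heat_def)
qed

lemma (in lri2) lri2_step_apply: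
  assumes A: "A \<in> carrier_mat N N" and entry: "\<And>i j. \<lbrakk>i < N; j < N\<rbrakk> \<Longrightarrow> A $$ (i, j) = a i j"
    and f1: "f1 = deriv_on \<beta> f" and \<tau>: "0 \<le> \<tau>" and i: "i < N" and v: "dim_vec v = N"
  shows "lri2_step \<beta> f A \<tau> v $ i = step \<tau> (\<lambda>j. v $ j) i"
proof -
  let ?E = "mat_exp (smult_mat \<tau> A)"
  have E: "?E \<in> carrier_mat N N" using A by (simp add: mat_exp_def)
  have exp_apply: "(?E *\<^sub>v y) $ i = heat \<tau> (\<lambda>j. y $ j) i" if "dim_vec y = N" for y
    by (rule mat_exp_apply[OF A entry \<tau> i that])
  have J: "(jacobian \<beta> f v *\<^sub>v map_vec f v) $ j = f1 (v $ j) * f (v $ j)" if j: "j < N" for j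
  proof -
    have "(jacobian \<beta> f v *\<^sub>v map_vec f v) $ j = (\<Sum>l<N. (if j = l then f1 (v $ j) else 0) * f (v $ l))"
      using j v by (auto simp: jacobian_def scalar_prod_def lessThan_atLeast0 f1 intro!: sum.cong)
    also have "\<dots> = (\<Sum>l<N. if j = l then f1 (v $ j) * f (v $ l) else 0)"
      by (intro sum.cong) auto
    finally show ?thesis using j by simp
  qed
  have "(?E *\<^sub>v v) $ i = heat \<tau> (\<lambda>j. v $ j) i" by (rule exp_apply[OF v])
  moreover have "(?E *\<^sub>v map_vec f v) $ i = heat \<tau> (\<lambda>j. f (v $ j)) i"
    using v by (subst exp_apply) (simp, rule heat_cong[OF _ i], simp)
  moreover have "(?E *\<^sub>v (jacobian \<beta> f v *\<^sub>v map_vec f v)) $ i = heat \<tau> (\<lambda>j. f1 (v $ j) * f (v $ j)) i"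
    using v by (subst exp_apply) (simp add: jacobian_def, rule heat_cong[OF J i])
  ultimately show ?thesis
    using E i by (simp add: lri2_step_def Let_def step_def)
qed

lemma dim_lri2_step [simp]: "dim_vec (lri2_step \<beta> f A \<tau> v) = dim_row A"
  by (simp add: lri2_step_def Let_def mat_exp_def)

section \<open>Derivatives, extrema and the step size bound on a closed interval\<close>

lemma differentiable_on_Icc_deriv_on:
  assumes "g differentiable_on {-r..r}" and "x \<in> {-r..r}"
  shows "(g has_real_derivative deriv_on r g x) (at x within {-r..r})"
  using assms unfolding differentiable_on_def deriv_on_def has_real_derivative_iff_has_vector_derivative
  by (simp add: vector_derivative_works)

text \<open>For \<open>0 < r\<close> no point of the interval is isolated, so the derivative within
  it is unique.\<close>

lemma deriv_on_eqI:
  assumes "0 < r" and "x \<in> {-r..r}" and "(g has_real_derivative D) (at x within {-r..r})"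
  shows "deriv_on r g x = D"
  using assms vector_derivative_within_cbox[of "-r" r x g D]
  by (simp add: deriv_on_def has_real_derivative_iff_has_vector_derivative)

lemma max_abs_ge:
  assumes "continuous_on {-r..r} g" and "x \<in> {-r..r}"
  shows "\<bar>g x\<bar> \<le> max_abs r g"
proof -
  have "compact ((\<lambda>x. \<bar>g x\<bar>) ` {-r..r})"
    using assms(1) by (intro compact_continuous_image continuous_intros) auto
  then show ?thesis unfolding max_abs_def
    using assms(2) by (intro cSUP_upper bounded_imp_bdd_above compact_imp_bounded)
qed

lemma INF_Icc_le:
  fixes g :: "real \<Rightarrow> real"
  assumes "continuous_on {l..r} g" and "x \<in> {l..r}"
  shows "(INF x\<in>{l..r}. g x) \<le> g x"
proof -
  have "compact (g ` {l..r})" using assms(1) by (intro compact_continuous_image) auto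
  then show ?thesis
    using assms(2) by (intro cINF_lower bounded_imp_bdd_below compact_imp_bounded)
qed

lemma delta0_pos: "0 < omega0 \<beta> f \<Longrightarrow> 0 < delta0 \<beta> f"
  unfolding delta0_def by (auto intro!: divide_pos_pos)

text \<open>The number \<open>\<delta>\<close> in \<^const>\<open>delta0\<close> is the positive root of \<open>q \<delta>\<^sup>2 + \<delta> = 7 / 4\<close> with \<open>q = \<omega>\<^sub>0\<^sup>2 \<omega>\<^sub>1\<close>.\<close>

lemma delta0_bounds:
  assumes "0 < omega0 \<beta> f" and "0 \<le> s" "s \<le> delta0 \<beta> f"
  shows "s \<le> 1" "s + (s * omega0 \<beta> f)\<^sup>2 * omega1 \<beta> f \<le> 7 / 4"
proof -
  show le1: "s \<le> 1" using assms(3) by (simp add: delta0_def split: if_splits)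
  let ?q = "(omega0 \<beta> f)\<^sup>2 * omega1 \<beta> f"
  define \<delta> where "\<delta> = (-1 + sqrt (1 + 7 * ?q)) / (2 * ?q)"
  have d: "delta0 \<beta> f = (if omega1 \<beta> f > 0 then min 1 \<delta> else 1)"
    by (simp add: delta0_def \<delta>_def mult.assoc)
  have q: "0 < ?q" if "omega1 \<beta> f > 0" using that assms(1) by simp
  show "s + (s * omega0 \<beta> f)\<^sup>2 * omega1 \<beta> f \<le> 7 / 4"
  proof (cases "omega1 \<beta> f > 0")
    case True
    then have s: "s \<le> \<delta>" using assms(3) d by auto
    have "2 * ?q * \<delta> + 1 = sqrt (1 + 7 * ?q)" using q[OF True] by (simp add: \<delta>_def)
    then have "(2 * ?q * \<delta> + 1)\<^sup>2 = 1 + 7 * ?q" using q[OF True] by simp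
    then have "4 * ?q * (?q * \<delta>\<^sup>2 + \<delta>) = 4 * ?q * (7 / 4)"
      by (simp add: power2_eq_square algebra_simps)
    then have root: "?q * \<delta>\<^sup>2 + \<delta> = 7 / 4"
      using q[OF True] by (metis mult_cancel_left mult_pos_pos order_less_irrefl zero_less_numeral)
    have "?q * s\<^sup>2 \<le> ?q * \<delta>\<^sup>2"
      using q[OF True] s assms(2) by (intro mult_left_mono power_mono) auto
    moreover have "(s * omega0 \<beta> f)\<^sup>2 * omega1 \<beta> f = ?q * s\<^sup>2"
      by (simp add: power_mult_distrib mult_ac)
    ultimately show ?thesis using root s by linarith
  next
    case False
    then have "(s * omega0 \<beta> f)\<^sup>2 * omega1 \<beta> f \<le> 0" by (intro mult_nonneg_nonpos) auto
    then show ?thesis using le1 by linarith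
  qed
qed

section \<open>The constants of a bistable nonlinearity\<close>

locale bistable =
  fixes \<beta> :: real and f :: "real \<Rightarrow> real"
  assumes beta_pos: "0 < \<beta>" and f_right: "f \<beta> \<le> 0" and f_left: "0 \<le> f (- \<beta>)"
    and C2: "C2_on \<beta> f" and nonconstant: "\<not> f constant_on {-\<beta>..\<beta>}"
begin

abbreviation "f1 \<equiv> deriv_on \<beta> f"
abbreviation "f2 \<equiv> deriv_on \<beta> (deriv_on \<beta> f)"

lemma f_deriv: "x \<in> {-\<beta>..\<beta>} \<Longrightarrow> (f has_real_derivative f1 x) (at x within {-\<beta>..\<beta>})"
  and f1_deriv: "x \<in> {-\<beta>..\<beta>} \<Longrightarrow> (f1 has_real_derivative f2 x) (at x within {-\<beta>..\<beta>})"
  using C2 by (auto simp: C2_on_def intro: differentiable_on_Icc_deriv_on)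

lemma continuous: "continuous_on {-\<beta>..\<beta>} f" "continuous_on {-\<beta>..\<beta>} f1" "continuous_on {-\<beta>..\<beta>} f2"
  using C2 by (auto simp: C2_on_def intro: differentiable_imp_continuous_on)

lemma f1f_deriv_on: "x \<in> {-\<beta>..\<beta>} \<Longrightarrow> deriv_on \<beta> (\<lambda>x. f1 x * f x) x = f2 x * f x + f1 x * f1 x"
  by (rule deriv_on_eqI[OF beta_pos]) (auto intro!: derivative_eq_intros f_deriv f1_deriv)

sublocale nonlinearity \<beta> f f1 f2 "F0 \<beta> f" "F1 \<beta> f" "F2 \<beta> f" "F3 \<beta> f"
proof
  have "continuous_on {-\<beta>..\<beta>} (deriv_on \<beta> (\<lambda>x. f1 x * f x))"
    using f1f_deriv_on continuous
    by (subst continuous_on_cong[OF refl f1f_deriv_on]) (auto intro!: continuous_intros)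
  note bound = max_abs_ge[OF this]
  show "\<bar>f2 x * f x + f1 x * f1 x\<bar> \<le> F3 \<beta> f" if "x \<in> {-\<beta>..\<beta>}" for x
    unfolding F3_def f1f_deriv_on[OF that, symmetric] using that by (rule bound)
qed (use beta_pos f_right f_left f_deriv f1_deriv continuous max_abs_ge in
    \<open>simp_all add: F0_def F1_def F2_def\<close>)

text \<open>If the Lipschitz constant were 0, \<open>f\<close> would be constant. Positivity passes
  to \<open>F4\<close>, by which the error constant is divided.\<close>

lemma F1_pos: "0 < F1 \<beta> f"
proof (rule ccontr)
  assume "\<not> 0 < F1 \<beta> f"
  then have "F1 \<beta> f = 0" using F_nonneg by simp
  then have "f x = f 0" if "x \<in> {-\<beta>..\<beta>}" for x
    using f_lipschitz[OF that, of 0] beta_pos by simp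
  then show False using nonconstant unfolding constant_on_def by blast
qed

text \<open>Without a negative slope \<open>f\<close> would be nondecreasing, and the signs at the
  end points would squeeze it to 0, contrary to nonconstancy.\<close>

lemma omega0_pos: "0 < omega0 \<beta> f"
proof -
  have "(INF x\<in>{-\<beta>..\<beta>}. f1 x) < 0"
  proof (rule ccontr)
    assume *: "\<not> (INF x\<in>{-\<beta>..\<beta>}. f1 x) < 0"
    then have pos: "0 \<le> f1 x" if "x \<in> {-\<beta>..\<beta>}" for x
      using INF_Icc_le[OF continuous(2) that] by linarith
    have "f x = 0" if "x \<in> {-\<beta>..\<beta>}" for x
      using that f_left f_right
        nondecreasing_on_Icc[OF f_deriv pos, of "-\<beta>" x] nondecreasing_on_Icc[OF f_deriv pos, of x \<beta>]
      by force
    then show False using nonconstant by (auto simp: constant_on_def)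
  qed
  then show ?thesis by (simp add: omega0_def divide_less_0_iff)
qed

lemma f1_lower: "x \<in> {-\<beta>..\<beta>} \<Longrightarrow> - (1 / omega0 \<beta> f) \<le> f1 x"
  using INF_Icc_le[OF continuous(2), of x] by (simp add: omega0_def)

lemma f2f_lower: "x \<in> {-\<beta>..\<beta>} \<Longrightarrow> - omega1 \<beta> f \<le> f2 x * f x"
  unfolding omega1_def
  using INF_Icc_le[of "-\<beta>" \<beta> "\<lambda>x. f2 x * f x" x] continuous by (simp add: continuous_on_mult)

end

text \<open>\<open>\<delta> * \<omega>\<close> is the largest admissible step and the divisor is
  \<open>F4\<close>. The summand 1 and the absolute value keep the numerator positive for all
  arguments.\<close>

definition error_const ::
  "real \<Rightarrow> real \<Rightarrow> real \<Rightarrow> real \<Rightarrow> real \<Rightarrow> real \<Rightarrow> real \<Rightarrow> real \<Rightarrow> real \<Rightarrow> real \<Rightarrow> real" where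
  "error_const \<beta> \<delta> \<omega> B0 B1 B1' B2 B2' B3 \<alpha> =
     (1 + \<bar>taylor_const \<alpha> \<beta> B0 B1 B2 / 2 + expansion_const (exp (\<alpha> * (\<delta> * \<omega>))) \<alpha> \<beta> B0 B1 B2\<bar>)
       / (B1 + \<delta> * \<omega> * B3 / 2)"

theorem (in bistable) lri2_error:
  fixes T :: real and A :: "real mat" and u :: "real \<Rightarrow> real Matrix.vec"
  defines "K \<equiv> error_const \<beta> (delta0 \<beta> f) (omega0 \<beta> f) (F0 \<beta> f) (F1 \<beta> f) (F1_wide \<beta> f) (F2 \<beta> f)
      (F2_wide \<beta> f) (F3 \<beta> f) (mat_maxnorm A)"
  assumes T: "0 < T" and A: "rate_mat N A" and N: "0 < N"
    and sol: "ode_solution T A f v0 u" and range: "\<forall>t \<in> {0..T}. vec_maxnorm (u t) \<le> \<beta>"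
  shows "0 < K"
    and "\<lbrakk>0 < M; \<tau> = T / real M; \<tau> \<le> delta0 \<beta> f * omega0 \<beta> f; lri2_solution \<beta> f A \<tau> M (u 0) U; m \<le> M\<rbrakk>
      \<Longrightarrow> vec_maxnorm (U m - u (real m * \<tau>)) \<le> K * (exp (F4 \<beta> f * (real m * \<tau>)) - 1) * \<tau>\<^sup>2"
proof -
  have Ac: "A \<in> carrier_mat N N" using A by (simp add: rate_mat_def)
  then have row: "dim_row A = N" by simp
  interpret R: rate_matrix N "\<lambda>i j. A $$ (i, j)" "mat_maxnorm A" by (rule rate_matrix_rate_mat[OF A N])
  interpret S: lri2 N "\<lambda>i j. A $$ (i, j)" "mat_maxnorm A" \<beta> f f1 f2 "F0 \<beta> f" "F1 \<beta> f" "F2 \<beta> f" "F3 \<beta> f"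
    by unfold_locales
  define w where "w = omega0 \<beta> f"
  define \<delta> where "\<delta> = delta0 \<beta> f"
  have w: "0 < w" unfolding w_def by (rule omega0_pos)
  have "0 < \<delta>" unfolding \<delta>_def by (rule delta0_pos[OF omega0_pos])
  have F4: "F4 \<beta> f = F1 \<beta> f + \<delta> * w * F3 \<beta> f / 2" by (simp add: F4_def \<delta>_def w_def)
  have F4_pos: "0 < F4 \<beta> f" unfolding F4 using F1_pos F_nonneg w \<open>0 < \<delta>\<close> by (intro add_pos_nonneg) auto
  let ?c = "taylor_const (mat_maxnorm A) \<beta> (F0 \<beta> f) (F1 \<beta> f) (F2 \<beta> f) / 2
      + expansion_const (exp (mat_maxnorm A * (\<delta> * w))) (mat_maxnorm A) \<beta> (F0 \<beta> f) (F1 \<beta> f) (F2 \<beta> f)"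
  have K: "K = (1 + \<bar>?c\<bar>) / F4 \<beta> f" by (simp add: K_def error_const_def F4 \<delta>_def w_def)
  show "0 < K" unfolding K using F4_pos by (intro divide_pos_pos) auto
  have KF4: "?c \<le> K * F4 \<beta> f" unfolding K using F4_pos by simp
  have dim_u: "dim_vec (u t) = N" if "t \<in> {0..T}" for t using sol that row by (simp add: ode_solution_def)
  assume M: "0 < M" and \<tau>: "\<tau> = T / real M" "\<tau> \<le> delta0 \<beta> f * omega0 \<beta> f"
    and U: "lri2_solution \<beta> f A \<tau> M (u 0) U" and m: "m \<le> M"
  have \<tau>_pos: "0 < \<tau>" using T M by (simp add: \<tau>)
  have dim_U: "dim_vec (U k) = N" if "k \<le> M" for k
    using U that dim_u[of 0] T by (cases k) (auto simp: lri2_solution_def row)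
  \<comment> \<open>In units of \<open>omega0\<close>, the step \<open>\<tau> / w\<close> is at most
    \<open>delta0\<close>, and the two conclusions of \<open>delta0_bounds\<close> become the
    smallness conditions of the maximum principle.\<close>
  have s: "0 \<le> \<tau> / w" "\<tau> / w \<le> delta0 \<beta> f"
    using \<tau>_pos \<tau>(2) w by (auto simp: w_def divide_le_eq)
  note d = delta0_bounds[OF omega0_pos s]
  have "real m * \<tau> \<le> real M * \<tau>" using m \<tau>_pos by (intro mult_right_mono) auto
  moreover have "real M * \<tau> = T" using M by (simp add: \<tau>)
  ultimately have t: "real m * \<tau> \<in> {0..T}" using \<tau>_pos by simp
  have "\<bar>U m $ i - u (real m * \<tau>) $ i\<bar> \<le> K * (exp (F4 \<beta> f * (real m * \<tau>)) - 1) * \<tau>\<^sup>2" if i: "i < N" for i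
  \<comment> \<open>The \<open>w\<close> of \<open>global_error\<close>, which bounds
    \<open>f2 x * f x\<close> from below, becomes \<open>omega1 \<beta> f\<close>. The local
    \<open>w\<close> is \<open>omega0 \<beta> f\<close>, whose inverse is the slope bound
    \<kappa>.\<close>
  proof (rule S.global_error[where U = "\<lambda>m i. U m $ i" and u = "\<lambda>t i. u t $ i" and \<sigma> = "\<delta> * w"
        and M = M and T = T and \<kappa> = "1 / w" and w = "omega1 \<beta> f"])
    fix i t assume i: "i < N" and t: "t \<in> {0..T}"
    have rhs: "(A *\<^sub>v u t + map_vec f (u t)) $ i = R.L (($) (u t)) i + f (u t $ i)"
      using i dim_u[OF t] Ac by (simp add: R.L_def scalar_prod_def lessThan_atLeast0)
    show "((\<lambda>s. u s $ i) has_real_derivative R.L (($) (u t)) i + f (u t $ i)) (at t within {0..T})"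
      unfolding rhs[symmetric] using sol i t row unfolding ode_solution_def by blast
    have "\<bar>u t $ i\<bar> \<le> \<beta>" using vec_maxnorm_ge[of i "u t"] i dim_u[OF t] range t by fastforce
    then show "u t $ i \<in> {-\<beta>..\<beta>}" by (auto simp: abs_le_iff)
  next
    show "U 0 $ i = u 0 $ i" for i using U by (simp add: lri2_solution_def)
    show "U (Suc k) $ i = S.step \<tau> (($) (U k)) i" if "k < M" "i < N" for k i
      using U that \<tau>_pos dim_U[of k]
      by (simp add: lri2_solution_def S.lri2_step_apply[OF Ac])
    show "\<tau> \<le> \<delta> * w" using \<tau>(2) by (simp add: \<delta>_def w_def)
    show "real M * \<tau> \<le> T" using \<tau> M by simp
    show "\<tau> * (1 / w) \<le> 1" using s d by simp
    show "\<tau> * (1 / w) + \<tau>\<^sup>2 * omega1 \<beta> f \<le> 7 / 4" using d(2) w by (simp add: w_def)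
    show "- (1 / w) \<le> f1 x" if "x \<in> {-\<beta>..\<beta>}" for x using f1_lower[OF that] by (simp add: w_def)
  qed (use f2f_lower F4 F4_pos KF4 m i \<tau>_pos in auto)
  then show "vec_maxnorm (U m - u (real m * \<tau>)) \<le> K * (exp (F4 \<beta> f * (real m * \<tau>)) - 1) * \<tau>\<^sup>2"
    using dim_U[OF m] dim_u[OF t] N by (simp add: vec_maxnorm_le_iff)
qed

theorem theorem7:
  shows "\<exists>C :: real \<Rightarrow> real \<Rightarrow> real \<Rightarrow> real \<Rightarrow> real \<Rightarrow> real \<Rightarrow> real \<Rightarrow> real \<Rightarrow> real \<Rightarrow> real \<Rightarrow> real.
    \<forall>(T :: real) (h :: real) (\<epsilon> :: real) (\<beta> :: real) (f :: real \<Rightarrow> real) ns a b u0 u.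
      T > 0 \<and> h > 0 \<and> \<epsilon> > 0 \<and> uniform_grid a b ns h \<and>
      \<beta> > 0 \<and> f \<beta> \<le> 0 \<and> 0 \<le> f (- \<beta>) \<and> C2_on \<beta> f \<and> \<not> f constant_on {-\<beta>..\<beta>} \<and>
      sup_norm_on {a..b} u0 \<le> ereal \<beta> \<and>
      ode_solution T (smult_mat (\<epsilon>\<^sup>2) (discrete_laplacian h ns)) f (grid_values a h ns u0) u \<and>
      (\<forall>t \<in> {0..T}. vec_maxnorm (u t) \<le> \<beta>)
      \<longrightarrow>
      (let A = smult_mat (\<epsilon>\<^sup>2) (discrete_laplacian h ns);
           K = C \<beta> (delta0 \<beta> f) (omega0 \<beta> f) (F0 \<beta> f) (F1 \<beta> f) (F1_wide \<beta> f) (F2 \<beta> f) (F2_wide \<beta> f)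
                 (F3 \<beta> f) (mat_maxnorm A)
       in K > 0 \<and>
          (\<forall>(M :: nat) U. let \<Delta>t = T / real M in
             M > 0 \<and> \<Delta>t \<le> delta0 \<beta> f * omega0 \<beta> f \<and> lri2_solution \<beta> f A \<Delta>t M (u 0) U
             \<longrightarrow>
             (\<forall>m \<le> M. let t = real m * \<Delta>t in
                vec_maxnorm (U m - u t) \<le> K * (exp (F4 \<beta> f * t) - 1) * \<Delta>t\<^sup>2)))"
proof (rule exI[of _ error_const], intro allI impI, elim conjE)
  fix T h \<epsilon> \<beta> :: real and f :: "real \<Rightarrow> real" and ns a b u0 u
  let ?A = "smult_mat (\<epsilon>\<^sup>2) (discrete_laplacian h ns)"
  assume T: "T > 0" and grid: "uniform_grid a b ns h"
    and "\<beta> > 0" "f \<beta> \<le> 0" "0 \<le> f (- \<beta>)" "C2_on \<beta> f" "\<not> f constant_on {-\<beta>..\<beta>}"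
    and sol: "ode_solution T ?A f (grid_values a h ns u0) u"
    and range: "\<forall>t \<in> {0..T}. vec_maxnorm (u t) \<le> \<beta>"
  then interpret bistable \<beta> f by unfold_locales
  have A: "rate_mat (prod_list ns) ?A"
    by (intro rate_mat_smult rate_mat_discrete_laplacian[OF grid]) simp
  note error = lri2_error[OF T A rate_mat_discrete_laplacian(2)[OF grid] sol range]
  show "let A = ?A;
           K = error_const \<beta> (delta0 \<beta> f) (omega0 \<beta> f) (F0 \<beta> f) (F1 \<beta> f) (F1_wide \<beta> f) (F2 \<beta> f) (F2_wide \<beta> f)
                 (F3 \<beta> f) (mat_maxnorm A)
       in K > 0 \<and>
          (\<forall>(M :: nat) U. let \<Delta>t = T / real M in
             M > 0 \<and> \<Delta>t \<le> delta0 \<beta> f * omega0 \<beta> f \<and> lri2_solution \<beta> f A \<Delta>t M (u 0) U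
             \<longrightarrow>
             (\<forall>m \<le> M. let t = real m * \<Delta>t in
                vec_maxnorm (U m - u t) \<le> K * (exp (F4 \<beta> f * t) - 1) * \<Delta>t\<^sup>2))"
    unfolding Let_def using error by auto
qed

end
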